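(* Let $R>1$. Then $\mathcal{A}(A_R)$ and $\mathcal{A}(\mathbb{D}^* )$ are not strongly isomorphic; i.e. there is no map $\Psi:\mathcal{A}(A_R)\to\mathcal{A}(\mathbb{D}^* )$ which is a Fréchet algebra isomorphism $(\mathcal{A}(A_R),\star_{A_R,\hbar})\to(\mathcal{A}(\mathbb{D}^* ),\star_{\mathbb{D}^*,\hbar})$ simultaneously for all $\hbar\in\mathscr{D}$.
   Context: $A_R=\{z\in\mathbb{C}:1/R<|z|<R\}$, $\mathbb{D}^*=\mathbb{D}\setminus\{0\}$. Notation: $\mathbb{D}=\{z\in\mathbb{C}:|z|<1\}$, $\hat{\mathbb{C}}=\mathbb{C}\cup\{\infty\}$. For a complex manifold $M$, $\mathcal{H}(M)$ is the Fréchet space of holomorphic functions on $M$ with the topology of locally uniform convergence. Let $\Omega:=\hat{\mathbb{C}}^2\setminus\big(\{(z,w)\in\mathbb{C}^2: zw=1\}\cup\{(0,\infty)\}\cup\{(\infty,0)\}\big)$. The space $\mathcal{A}(\mathbb{D})$: the set of all $f:\mathbb{D}\to\mathbb{C}$ for which there is $F\in\mathcal{H}(\Omega)$ with $f(z)=F(z,\bar z)$ for all $z\in\mathbb{D}$ (such $F$ is unique); it carries the topology transported from $\mathcal{H}(\Omega)$ via $f\mapsto F$. Deformation parameter: $\hbar\in\mathscr{D}:=\mathbb{C}\setminus\{0,-1,-1/2,-1/3,\dots\}$; $c_0(\hbar)=1$ and $c_n(\hbar)=\hbar^n/\prod_{j=0}^{n-1}(1+j\hbar)$ for $n\ge1$.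 Peschl–Minda derivatives: for $z\in\mathbb{D}$ let $T_z(u)=(z+u)/(1+\bar z u)$; with $\partial=\frac12(\partial_x-i\partial_y)$ the Wirtinger derivative, for smooth $f:\mathbb{D}\to\mathbb{C}$ set $D^nf(z):=\partial_u^n(f\circ T_z)(0)$ and $\overline{D}^nf(z):=\overline{D^n(\bar f)(z)}$. Star product on $\mathbb{D}$: for $f,\tilde f\in\mathcal{A}(\mathbb{D})$ and $\hbar\in\mathscr{D}$, $(f\star_{\mathbb{D},\hbar}\tilde f)(z)=\sum_{n=0}^\infty\frac{c_n(\hbar)}{n!}\,\overline{D}^nf(z)\,D^n\tilde f(z)$; this series converges in $\mathcal{A}(\mathbb{D})$ and makes $(\mathcal{A}(\mathbb{D}),\star_{\mathbb{D},\hbar})$ a Fréchet algebra; it satisfies $(f\circ\varphi)\star_{\mathbb{D},\hbar}(g\circ\varphi)=(f\star_{\mathbb{D},\hbar}g)\circ\varphi$ for conformal automorphisms $\varphi$ of $\mathbb{D}$. Transfer to Riemann surfaces: a Riemann surface $X$ is hyperbolic if its universal cover is $\mathbb{D}$. For a universal covering $\pi:\mathbb{D}\to X$, $\mathcal{A}(X):=\{f:X\to\mathbb{C}: f\circ\pi\in\mathcal{A}(\mathbb{D})\}$, $f\star_{X,\hbar}g$ is defined by $(f\star_{X,\hbar}g)\circ\pi=(f\circ\pi)\star_{\mathbb{D},\hbar}(g\circ\pi)$, and $f_n\to f$ in $\mathcal{A}(X)$ iff $f_n\circ\pi\to f\circ\pi$ in $\mathcal{A}(\mathbb{D})$. These do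 not depend on the choice of $\pi$, and $(\mathcal{A}(X),\star_{X,\hbar})$ is a Fréchet algebra. A Fréchet algebra isomorphism is a linear bijection that is multiplicative and a homeomorphism. *)

theory Defs
  imports "HOL-Analysis.Analysis"
begin

(* Riemann sphere: complex option, None = infinity *)

definition Omega :: "(complex option \<times> complex option) set" where
  "Omega = UNIV - ({(Some z, Some w) | z w. z * w = 1} \<union> {(Some 0, None), (None, Some 0)})"

definition chart :: "bool \<Rightarrow> complex \<Rightarrow> complex option" where
  "chart b u = (if b then (if u = 0 then None else Some (1 / u)) else Some u)"

definition chart_dom :: "bool \<Rightarrow> bool \<Rightarrow> (complex \<times> complex) set" where
  "chart_dom a b = {(u, v). (chart a u, chart b v) \<in> Omega}"

(* holomorphic in two complex variables: complex (i.e. C-linear) Frechet derivative at every point *)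
definition holo2 :: "(complex \<times> complex \<Rightarrow> complex) \<Rightarrow> (complex \<times> complex) set \<Rightarrow> bool" where
  "holo2 G U \<longleftrightarrow> (\<forall>p\<in>U. \<exists>L. (G has_derivative L) (at p) \<and>
       (\<forall>v. L (\<i> * fst v, \<i> * snd v) = \<i> * L v))"

definition holo_Omega :: "(complex option \<times> complex option \<Rightarrow> complex) \<Rightarrow> bool" where
  "holo_Omega F \<longleftrightarrow> (\<forall>a b. holo2 (\<lambda>(u, v). F (chart a u, chart b v)) (chart_dom a b))"

definition locunif_Omega ::
  "(nat \<Rightarrow> complex option \<times> complex option \<Rightarrow> complex) \<Rightarrow> (complex option \<times> complex option \<Rightarrow> complex) \<Rightarrow> bool" where
  "locunif_Omega Fs F \<longleftrightarrow> (\<forall>a b K. compact K \<and> K \<subseteq> chart_dom a b \<longrightarrow>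
      uniform_limit K (\<lambda>n (u, v). Fs n (chart a u, chart b v)) (\<lambda>(u, v). F (chart a u, chart b v)) sequentially)"

abbreviation unit_disc :: "complex set" where "unit_disc \<equiv> ball 0 1"

definition represents :: "(complex option \<times> complex option \<Rightarrow> complex) \<Rightarrow> (complex \<Rightarrow> complex) \<Rightarrow> bool" where
  "represents F f \<longleftrightarrow> holo_Omega F \<and> (\<forall>z\<in>unit_disc. f z = F (Some z, Some (cnj z)))"

definition A_D :: "(complex \<Rightarrow> complex) set" where
  "A_D = {f. (\<forall>z. z \<notin> unit_disc \<longrightarrow> f z = 0) \<and> (\<exists>F. represents F f)}"

(* convergence of sequences in A(D) (topology transported from H(Omega)) *)
definition conv_D :: "(nat \<Rightarrow> complex \<Rightarrow> complex) \<Rightarrow> (complex \<Rightarrow> complex) \<Rightarrow> bool" where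
  "conv_D fs f \<longleftrightarrow> (\<exists>Fs F. (\<forall>n. represents (Fs n) (fs n)) \<and> represents F f \<and> locunif_Omega Fs F)"

definition hdom :: "complex set" where
  "hdom = {h. h \<noteq> 0 \<and> (\<forall>k::nat. k \<ge> 1 \<longrightarrow> h \<noteq> - 1 / of_nat k)}"

definition cc :: "complex \<Rightarrow> nat \<Rightarrow> complex" where
  "cc h n = h ^ n / (\<Prod>j<n. 1 + of_nat j * h)"

definition wirt :: "(complex \<Rightarrow> complex) \<Rightarrow> complex \<Rightarrow> complex" where
  "wirt g = (\<lambda>z. (vector_derivative (\<lambda>t::real. g (z + of_real t)) (at 0)
               - \<i> * vector_derivative (\<lambda>t::real. g (z + \<i> * of_real t)) (at 0)) / 2)"

definition Tmob :: "complex \<Rightarrow> complex \<Rightarrow> complex" where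
  "Tmob z u = (z + u) / (1 + cnj z * u)"

definition PM :: "nat \<Rightarrow> (complex \<Rightarrow> complex) \<Rightarrow> complex \<Rightarrow> complex" where
  "PM n f z = (wirt ^^ n) (\<lambda>u. f (Tmob z u)) 0"

definition PMbar :: "nat \<Rightarrow> (complex \<Rightarrow> complex) \<Rightarrow> complex \<Rightarrow> complex" where
  "PMbar n f z = cnj (PM n (\<lambda>x. cnj (f x)) z)"

definition star_D :: "complex \<Rightarrow> (complex \<Rightarrow> complex) \<Rightarrow> (complex \<Rightarrow> complex) \<Rightarrow> complex \<Rightarrow> complex" where
  "star_D h f g = (\<lambda>z. if z \<in> unit_disc
       then (\<Sum>n. cc h n / fact n * PMbar n f z * PM n g z) else 0)"

definition is_ucover :: "complex set \<Rightarrow> (complex \<Rightarrow> complex) \<Rightarrow> bool" where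
  "is_ucover X p \<longleftrightarrow> p holomorphic_on unit_disc \<and> covering_space unit_disc p X"

definition ucov :: "complex set \<Rightarrow> complex \<Rightarrow> complex" where
  "ucov X = (SOME p. is_ucover X p)"

definition pull :: "complex set \<Rightarrow> (complex \<Rightarrow> complex) \<Rightarrow> complex \<Rightarrow> complex" where
  "pull X f = (\<lambda>z. if z \<in> unit_disc then f (ucov X z) else 0)"

definition A_X :: "complex set \<Rightarrow> (complex \<Rightarrow> complex) set" where
  "A_X X = {f. (\<forall>x. x \<notin> X \<longrightarrow> f x = 0) \<and> pull X f \<in> A_D}"

definition star_X :: "complex set \<Rightarrow> complex \<Rightarrow> (complex \<Rightarrow> complex) \<Rightarrow> (complex \<Rightarrow> complex) \<Rightarrow> complex \<Rightarrow> complex" where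
  "star_X X h f g = (\<lambda>x. if x \<in> X
       then star_D h (pull X f) (pull X g) (SOME z. z \<in> unit_disc \<and> ucov X z = x) else 0)"

definition conv_X :: "complex set \<Rightarrow> (nat \<Rightarrow> complex \<Rightarrow> complex) \<Rightarrow> (complex \<Rightarrow> complex) \<Rightarrow> bool" where
  "conv_X X fs f \<longleftrightarrow> conv_D (\<lambda>n. pull X (fs n)) (pull X f)"

definition annulus :: "real \<Rightarrow> complex set" where
  "annulus R = {z. 1 / R < norm z \<and> norm z < R}"

definition punct_disc :: "complex set" where
  "punct_disc = ball 0 1 - {0}"

(* Psi is a Frechet algebra isomorphism (A(X), star_{X,h}) \<rightarrow> (A(Y), star_{Y,h}) for every h;
   homeomorphism is expressed by convergent sequences (the spaces are metrizable) *)
definition strong_iso :: "complex set \<Rightarrow> complex set \<Rightarrow> ((complex \<Rightarrow> complex) \<Rightarrow> (complex \<Rightarrow> complex)) \<Rightarrow> bool" where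
  "strong_iso X Y \<Psi> \<longleftrightarrow>
     bij_betw \<Psi> (A_X X) (A_X Y) \<and>
     (\<forall>f\<in>A_X X. \<forall>g\<in>A_X X. \<Psi> (\<lambda>x. f x + g x) = (\<lambda>y. \<Psi> f y + \<Psi> g y)) \<and>
     (\<forall>c. \<forall>f\<in>A_X X. \<Psi> (\<lambda>x. c * f x) = (\<lambda>y. c * \<Psi> f y)) \<and>
     (\<forall>h\<in>hdom. \<forall>f\<in>A_X X. \<forall>g\<in>A_X X. \<Psi> (star_X X h f g) = star_X Y h (\<Psi> f) (\<Psi> g)) \<and>
     (\<forall>fs f. (\<forall>n. fs n \<in> A_X X) \<and> f \<in> A_X X \<longrightarrow>
        (conv_X X fs f \<longleftrightarrow> conv_X Y (\<lambda>n. \<Psi> (fs n)) (\<Psi> f)))"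

end

theory Submission
  imports Defs "HOL-Complex_Analysis.Complex_Analysis"
begin

text \<open>In the half-plane uniformization the complexification of the disc is the set of pairs
  \<open>\<zeta> \<noteq> \<omega>\<close> of points of the sphere. Invariance under the parabolic deck group \<open>\<zeta> \<mapsto> \<zeta> + 1\<close> of the
  punctured disc forces a function to be entire in \<open>t = 1 / (\<zeta> - \<omega>)\<close>, while the annulus carries
  the function \<open>s = (\<zeta> + \<omega>) / (\<zeta> - \<omega>)\<close>, invariant under the hyperbolic deck group. Both \<open>t\<close> and
  \<open>s\<close> are of the form \<open>(A (1 + z w) + B z + C w) / (1 - z w)\<close>, with \<open>A\<^sup>2 - B C\<close> equal to \<open>0\<close> and \<open>1\<close>.
  One computes exactly \<open>s \<star> s = s\<^sup>2 + \<hbar> (s\<^sup>2 - 1)\<close>, whereas \<open>h(t) \<star> h(t) = h\<^sup>2 + \<hbar> t\<^sup>2 h'(t)\<^sup>2 + O(\<hbar>\<^sup>2)\<close>.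
  If \<open>h(t)\<close> is the image of \<open>s\<close> under a strong isomorphism, comparing coefficients as
  \<open>\<hbar> \<rightarrow> 0\<close> gives \<open>t\<^sup>2 h'\<^sup>2 = h\<^sup>2 - 1\<close>. This equation has only constant entire solutions, because
  \<open>t\<^sup>2\<close> has a double zero, and a constant cannot be the image of \<open>s\<close>.\<close>

section \<open>Lifting the universal covering through the exponential\<close>

text \<open>A strong isomorphism \<open>\<Psi>\<close> is one linear map for all parameters but need
  not respect the pointwise product, so the image of s^2 is not known beforehand. It is recovered
  from the parameter: \<open>\<Psi>\<close> turns the star square of s into an expression affine in
  it, with unknown coefficients \<open>\<Psi> s2\<close> and \<open>\<Psi> w\<close>, while the star
  square of h(t) is in general an infinite series. Both coefficients can then be read off, and they
  differ by 1 because \<open>\<Psi>\<close> preserves the unit. The values 0 and 1 have a geometric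
  origin: up to a factor 4, A^2 - B C is the discriminant of C + 2 A z + B z^2, whose zeros are the
  fixed points of the deck group, one double point in the parabolic case and two points in the
  hyperbolic case. A further obstacle is that \<open>ucov\<close> is an arbitrary choice of
  covering. Lifting it through the exponential determines it up to an automorphism of the disc,
  which is why forms with general coefficients are carried along.\<close>

lemma covering_space_restrict:
  assumes cov: "covering_space c p S" and TS: "T \<subseteq> S"
  shows "covering_space (c \<inter> p -` T) p T"
proof
  show "continuous_on (c \<inter> p -` T) p"
    using cov by (meson continuous_on_subset covering_space_imp_continuous inf_le1)
  show "p ` (c \<inter> p -` T) = T"
    using covering_space_imp_surjective[OF cov] TS by auto
next
  fix x assume "x \<in> T"
  then obtain N V where N: "x \<in> N" "openin (top_of_set S) N" and V: "\<Union>V = c \<inter> p -` N"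
      "\<And>u. u \<in> V \<Longrightarrow> openin (top_of_set c) u" "pairwise disjnt V"
      "\<And>u. u \<in> V \<Longrightarrow> \<exists>q. homeomorphism u N p q"
    using cov TS unfolding covering_space_def by (meson subsetD)
  let ?V = "(\<lambda>u. u \<inter> p -` T) ` V"
  have "\<Union>?V = (c \<inter> p -` T) \<inter> p -` (N \<inter> T)"
    using V(1) by auto
  moreover have "openin (top_of_set (c \<inter> p -` T)) (u \<inter> p -` T)" if "u \<in> V" for u
  proof -
    have "openin (top_of_set c) u"
      using V(2) that by blast
    then obtain W where "open W" "u = c \<inter> W"
      by (auto simp: openin_open)
    then show ?thesis
      by (auto simp: openin_open)
  qed
  moreover have "pairwise disjnt ?V"
    using V(3) unfolding pairwise_def disjnt_def by blast
  moreover have "\<exists>q. homeomorphism (u \<inter> p -` T) (N \<inter> T) p q" if u: "u \<in> V" for u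
  proof -
    obtain q where q: "homeomorphism u N p q"
      using V(4)[OF u] by blast
    then have "p ` (u \<inter> p -` T) = N \<inter> T"
      by (force simp: homeomorphism_def)
    then show ?thesis
      by (intro exI[of _ q] homeomorphism_of_subsets[OF q, where T'' = "N \<inter> T"]) auto
  qed
  moreover have "openin (top_of_set T) (N \<inter> T)"
    using N(2) TS by (auto simp: openin_open)
  ultimately show "\<exists>N'. x \<in> N' \<and> openin (top_of_set T) N' \<and>
      (\<exists>v. \<Union>v = c \<inter> p -` T \<inter> p -` N' \<and> (\<forall>u\<in>v. openin (top_of_set (c \<inter> p -` T)) u) \<and>
           pairwise disjnt v \<and> (\<forall>u\<in>v. \<exists>q. homeomorphism u N' p q))"
    using N(1) \<open>x \<in> T\<close> by (intro exI[of _ "N \<inter> T"] conjI exI[of _ ?V]) auto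
qed

text \<open>Transports the exponential covering to the disc along a Riemann map; this supplies the
  witness for the choice in \<open>ucov\<close>.\<close>

lemma covering_space_compose_homeomorphism:
  assumes cov: "covering_space U p S" and hom: "homeomorphism D U g f"
  shows "covering_space D (p \<circ> g) S"
proof
  have g: "continuous_on D g" "g ` D = U" "continuous_on U f" "f ` U = D"
      "\<And>x. x \<in> D \<Longrightarrow> f (g x) = x" "\<And>y. y \<in> U \<Longrightarrow> g (f y) = y"
    using hom by (auto simp: homeomorphism_def)
  show "continuous_on D (p \<circ> g)"
    using cov g by (intro continuous_on_compose) (auto dest: covering_space_imp_continuous)
  show "(p \<circ> g) ` D = S"
    using covering_space_imp_surjective[OF cov] g by (metis image_comp)
  fix x assume "x \<in> S"
  then obtain N V where N: "x \<in> N" "openin (top_of_set S) N" and V: "\<Union>V = U \<inter> p -` N"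
      "\<And>u. u \<in> V \<Longrightarrow> openin (top_of_set U) u" "pairwise disjnt V"
      "\<And>u. u \<in> V \<Longrightarrow> \<exists>q. homeomorphism u N p q"
    using cov unfolding covering_space_def by meson
  have hom': "homeomorphism U D f g"
    using hom homeomorphism_sym by blast
  have sub: "u \<subseteq> U" if "u \<in> V" for u
    using V(1) that by blast
  let ?V = "(\<lambda>u. f ` u) ` V"
  have "\<Union>?V = D \<inter> (p \<circ> g) -` N"
  proof -
    have "f ` (U \<inter> p -` N) = D \<inter> (p \<circ> g) -` N"
    proof
      show "D \<inter> (p \<circ> g) -` N \<subseteq> f ` (U \<inter> p -` N)"
        using g(2,5) by (auto intro!: image_eqI[where x = "g _"])
    qed (use g(4,6) in auto)
    then show ?thesis
      by (simp add: V(1) flip: image_Union)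
  qed
  moreover have "openin (top_of_set D) (f ` u)" if "u \<in> V" for u
    using V(2)[OF that] hom' homeomorphism_imp_open_map by metis
  moreover have "pairwise disjnt ?V"
  proof (clarsimp simp: pairwise_def disjnt_def)
    fix u v assume uv: "u \<in> V" "v \<in> V" "f ` u \<noteq> f ` v"
    then have "u \<inter> v = {}"
      using V(3) unfolding pairwise_def disjnt_def by blast
    then show "f ` u \<inter> f ` v = {}"
      using inj_on_image_Int[of f U u v] inj_on_inverseI[of U g f] g(6) sub[OF uv(1)] sub[OF uv(2)]
      by (metis image_empty)
  qed
  moreover have "\<exists>q. homeomorphism (f ` u) N (p \<circ> g) q" if u: "u \<in> V" for u
  proof -
    obtain q where q: "homeomorphism u N p q"
      using V(4)[OF u] by blast
    have "g ` f ` u = u"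
      using g(6) sub[OF u] by force
    then have "homeomorphism (f ` u) u g f"
      using sub[OF u] g(4) by (intro homeomorphism_of_subsets[OF hom, where T'' = u]) auto
    then show ?thesis
      using homeomorphism_compose q by blast
  qed
  ultimately show "\<exists>N'. x \<in> N' \<and> openin (top_of_set S) N' \<and>
      (\<exists>v. \<Union>v = D \<inter> (p \<circ> g) -` N' \<and> (\<forall>u\<in>v. openin (top_of_set D) u) \<and>
           pairwise disjnt v \<and> (\<forall>u\<in>v. \<exists>q. homeomorphism u N' (p \<circ> g) q))"
    using N by (intro exI[of _ N] conjI exI[of _ ?V]) auto
qed

text \<open>Simple connectedness also gives a lift in the opposite direction; each composite is a
  lift that agrees with the identity at one point, hence everywhere.\<close>

lemma covering_space_lift_bij:
  fixes p :: "'a::real_normed_vector \<Rightarrow> 'b::real_normed_vector"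
    and q :: "'c::real_normed_vector \<Rightarrow> 'b"
  assumes p: "covering_space D p X" and q: "covering_space U q X"
    and D: "simply_connected D" and U: "simply_connected U" "locally path_connected U"
    and L: "continuous_on D L" "L \<in> D \<rightarrow> U" "\<And>z. z \<in> D \<Longrightarrow> q (L z) = p z" and z0: "z0 \<in> D"
  shows "bij_betw L D U"
proof -
  have pX: "p \<in> D \<rightarrow> X" "continuous_on D p" and qX: "q \<in> U \<rightarrow> X" "continuous_on U q"
    using p q by (auto simp: covering_space_def)
  obtain m where m: "continuous_on U m" "m \<in> U \<rightarrow> D" "m (L z0) = z0" "\<And>y. y \<in> U \<Longrightarrow> p (m y) = q y"
    using covering_space_lift_strong[OF p z0, of "L z0" U q] U qX L z0 by auto
  have mL: "(m \<circ> L) z = id z" if "z \<in> D" for z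
  proof (rule covering_space_lift_unique[OF p, where T = D and a = z0 and f = p and ?g1.0 = "m \<circ> L" and ?g2.0 = id])
    show "continuous_on D (m \<circ> L)"
      by (metis L(1,2) m(1) continuous_on_compose continuous_on_subset image_subset_iff_funcset)
    show "connected D"
      by (simp add: D simply_connected_imp_connected)
  qed (use L m z0 that pX in \<open>auto simp: Pi_iff\<close>)
  have Lm: "(L \<circ> m) y = id y" if "y \<in> U" for y
  proof (rule covering_space_lift_unique[OF q, where T = U and a = "L z0" and f = q and ?g1.0 = "L \<circ> m" and ?g2.0 = id])
    show "continuous_on U (L \<circ> m)"
      by (metis L(1) m(1,2) continuous_on_compose continuous_on_subset image_subset_iff_funcset)
    show "connected U"
      by (simp add: U simply_connected_imp_connected)
  qed (use L m z0 that qX in \<open>auto simp: Pi_iff\<close>)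
  show ?thesis
    using mL Lm L m by (intro bij_betw_byWitness[where f' = m]) (auto simp: Pi_iff)
qed

text \<open>The chosen covering is unknown, but it lifts through \<open>exp\<close>, and the lift is
  bijective because both coverings have simply connected total spaces. The conditions on the
  preimage of \<open>X\<close> let the Riemann mapping theorem apply.\<close>

lemma ucov_eq_exp:
  assumes X: "open X" "0 \<notin> X" and U: "convex (exp -` X)" "exp -` X \<noteq> {}" "exp -` X \<noteq> UNIV"
  obtains L where "L holomorphic_on unit_disc" "bij_betw L unit_disc (exp -` X)"
    "\<And>z. z \<in> unit_disc \<Longrightarrow> ucov X z = exp (L z)"
    "ucov X ` unit_disc = X"
proof -
  let ?U = "exp -` X :: complex set"
  have opU: "open ?U"
    using X(1) by (intro open_vimage continuous_intros)
  have simp: "simply_connected ?U" "locally path_connected ?U"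
    using U(1) convex_imp_simply_connected convex_imp_locally_path_connected by auto
  have covE: "covering_space ?U exp X"
    using covering_space_restrict[OF covering_space_exp_punctured_plane, of X] X by auto
  obtain f g where f: "f holomorphic_on ?U" and g: "g holomorphic_on unit_disc"
    and fg: "\<And>z. z \<in> ?U \<Longrightarrow> f z \<in> unit_disc \<and> g (f z) = z"
    and gf: "\<And>z. z \<in> unit_disc \<Longrightarrow> g z \<in> ?U \<and> f (g z) = z"
    using Riemann_mapping_theorem[of ?U] opU simp U by blast
  have "homeomorphism unit_disc ?U g f"
    unfolding homeomorphism_def
    using f g fg gf by (force simp: holomorphic_on_imp_continuous_on image_iff)
  then have "covering_space unit_disc (exp \<circ> g) X"
    using covE covering_space_compose_homeomorphism by blast
  moreover have "(exp \<circ> g) holomorphic_on unit_disc"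
    using g by (intro holomorphic_on_compose holomorphic_on_exp)
  ultimately have "is_ucover X (exp \<circ> g)"
    unfolding is_ucover_def by blast
  then have "is_ucover X (ucov X)"
    unfolding ucov_def by (rule someI[of "is_ucover X"])
  then have hol: "ucov X holomorphic_on unit_disc" and cov: "covering_space unit_disc (ucov X) X"
    by (auto simp: is_ucover_def)
  have im: "ucov X ` unit_disc = X"
    using cov covering_space_imp_surjective by blast
  obtain L where L: "L holomorphic_on unit_disc" "L \<in> unit_disc \<rightarrow> ?U"
      "\<And>y. y \<in> unit_disc \<Longrightarrow> exp (L y) = ucov X y"
    using covering_space_lift_holomorphic[OF covE opU holomorphic_on_exp hol]
      im convex_imp_simply_connected convex_imp_locally_path_connected convex_ball
    by (metis funcsetI imageI)
  have "bij_betw L unit_disc ?U"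
    using covering_space_lift_bij[OF cov covE _ simp, of L 0] L
    by (simp add: convex_imp_simply_connected holomorphic_on_imp_continuous_on)
  then show ?thesis
    using that L im by metis
qed

section \<open>Uniformization by the upper half-plane\<close>

lemma cayley_less_one:
  assumes "Im a > 0" "Im \<zeta> > 0"
  shows "norm ((\<zeta> - a) / (\<zeta> - cnj a)) < 1"
proof -
  have ne: "\<zeta> \<noteq> cnj a"
    using assms by (auto simp: complex_eq_iff)
  have "(Im \<zeta> - Im a)\<^sup>2 < (Im \<zeta> + Im a)\<^sup>2"
    using assms by (simp add: power2_eq_square algebra_simps)
  then have "(norm (\<zeta> - a))\<^sup>2 < (norm (\<zeta> - cnj a))\<^sup>2"
    unfolding cmod_power2 by simp
  then have "norm (\<zeta> - a) < norm (\<zeta> - cnj a)"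
    using norm_ge_zero power2_less_imp_less by blast
  then show ?thesis
    using ne by (simp add: norm_divide)
qed

lemma Im_cayley_inverse_pos:
  assumes "Im a > 0" "norm w < 1"
  shows "Im ((a - cnj a * w) / (1 - w)) > 0"
proof -
  have w: "w \<noteq> 1"
    using assms by auto
  have "(norm w)\<^sup>2 < 1"
    using assms by (simp add: abs_square_less_1)
  then have "0 < Im a * (1 - ((Re w)\<^sup>2 + (Im w)\<^sup>2))"
    using assms by (simp add: cmod_power2)
  also have "\<dots> = Im (a - cnj a * w) * Re (1 - w) - Re (a - cnj a * w) * Im (1 - w)"
    by (simp add: algebra_simps power2_eq_square)
  finally have "0 < Im (a - cnj a * w) * Re (1 - w) - Re (a - cnj a * w) * Im (1 - w)" .
  moreover have "0 < (Re (1 - w))\<^sup>2 + (Im (1 - w))\<^sup>2"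
    using w by (metis complex_neq_0 right_minus_eq)
  ultimately show ?thesis
    unfolding Im_divide by (rule divide_pos_pos)
qed

text \<open>By the Schwarz lemma applied in both directions, the coordinate change is a rotation.\<close>

lemma upper_half_plane_uniformization:
  assumes hol: "\<phi> holomorphic_on unit_disc" and bij: "bij_betw \<phi> unit_disc {\<zeta>. Im \<zeta> > 0}"
  obtains a e where "Im a > 0" "norm e = 1"
    "\<And>z. z \<in> unit_disc \<Longrightarrow> \<phi> z = (a - cnj a * (e * z)) / (1 - e * z)"
proof -
  have up: "Im (\<phi> z) > 0" if "z \<in> unit_disc" for z
    using bij that by (auto simp: bij_betw_def)
  obtain g where g: "g holomorphic_on {\<zeta>. Im \<zeta> > 0}" "\<And>z. z \<in> unit_disc \<Longrightarrow> g (\<phi> z) = z"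
    using holomorphic_has_inverse[OF hol] bij by (metis bij_betw_def open_ball)
  have gim: "g \<zeta> \<in> unit_disc" "\<phi> (g \<zeta>) = \<zeta>" if "Im \<zeta> > 0" for \<zeta>
  proof -
    obtain z where "z \<in> unit_disc" "\<zeta> = \<phi> z"
      using bij \<open>Im \<zeta> > 0\<close> by (metis bij_betw_imp_surj_on imageE mem_Collect_eq)
    then show "g \<zeta> \<in> unit_disc" "\<phi> (g \<zeta>) = \<zeta>"
      using g(2) by simp_all
  qed
  define a where "a = \<phi> 0"
  have a: "Im a > 0"
    using up[of 0] by (simp add: a_def)
  define f where "f = (\<lambda>z. (\<phi> z - a) / (\<phi> z - cnj a))"
  define k where "k = (\<lambda>w. g ((a - cnj a * w) / (1 - w)))"
  have ne: "\<phi> z \<noteq> cnj a" if "norm z < 1" for z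
    using up[of z] a that by (auto simp: complex_eq_iff)
  have fhol: "f holomorphic_on ball 0 1"
    unfolding f_def using hol ne by (intro holomorphic_intros) auto
  have flt: "norm (f z) < 1" if "norm z < 1" for z
    unfolding f_def using cayley_less_one[OF a up] that by simp
  have f0: "f 0 = 0"
    by (simp add: f_def a_def)
  have "(\<lambda>w. (a - cnj a * w) / (1 - w)) holomorphic_on ball 0 1"
    by (intro holomorphic_intros) auto
  then have khol: "k holomorphic_on ball 0 1"
    unfolding k_def using holomorphic_on_compose_gen[OF _ g(1)] Im_cayley_inverse_pos[OF a]
    by (force simp: o_def image_subset_iff)
  have klt: "norm (k w) < 1" if "norm w < 1" for w
    using gim Im_cayley_inverse_pos[OF a that] by (auto simp: k_def)
  have k0: "k 0 = 0"
    using g(2)[of 0] by (simp add: k_def a_def)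
  have inv: "(a - cnj a * f z) / (1 - f z) = \<phi> z" if "norm z < 1" for z
  proof -
    have "1 - f z = (a - cnj a) / (\<phi> z - cnj a)"
      using ne[OF that] by (simp add: f_def field_simps)
    moreover have "a - cnj a * f z = \<phi> z * (a - cnj a) / (\<phi> z - cnj a)"
      using ne[OF that] by (simp add: f_def field_simps)
    moreover have "a \<noteq> cnj a"
      using a by (auto simp: complex_eq_iff)
    ultimately show ?thesis
      using ne[OF that] by simp
  qed
  have kf: "k (f z) = z" if "norm z < 1" for z
    using inv[OF that] g(2) that by (simp add: k_def)
  \<comment> \<open>The point 1/2 is arbitrary: equality in the Schwarz lemma at one non-zero point
    already forces a rotation.\<close>
  have "norm (f (1/2)) = norm (1/2 :: complex)"
  proof (rule antisym)
    show "norm (f (1/2)) \<le> norm (1/2 :: complex)"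
      using Schwarz_Lemma(1)[OF fhol f0 flt, of "1/2"] by simp
    show "norm (1/2 :: complex) \<le> norm (f (1/2))"
      using Schwarz_Lemma(1)[OF khol k0 klt flt, of "1/2"] kf[of "1/2"] by simp
  qed
  then have "\<exists>z. norm z < 1 \<and> z \<noteq> 0 \<and> norm (f z) = norm z"
    by (intro exI[of _ "1/2"]) auto
  then obtain e where "\<And>z. norm z < 1 \<Longrightarrow> f z = e * z" "norm e = 1"
    using Schwarz_Lemma(3)[OF fhol f0 flt, of 0] by auto
  then show ?thesis
    using that[of a e] a inv by auto
qed

section \<open>Wirtinger derivatives and the star product of quadratic forms\<close>

text \<open>The real differential is a dz + b d(cnj z), so \<open>a\<close> is the Wirtinger
  derivative. Full differentiability, rather than the two partial derivatives in
  \<open>wirt\<close>, is what makes the product and chain rules available.\<close>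

definition has_wirt :: "(complex \<Rightarrow> complex) \<Rightarrow> complex \<Rightarrow> complex \<Rightarrow> bool" where
  "has_wirt f a z \<longleftrightarrow> (\<exists>b. (f has_derivative (\<lambda>x. a * x + b * cnj x)) (at z))"

lemma has_wirt_imp_wirt:
  assumes "has_wirt f a z"
  shows "wirt f z = a"
proof -
  obtain b where b: "(f has_derivative (\<lambda>x. a * x + b * cnj x)) (at z)"
    using assms has_wirt_def by auto
  have "((\<lambda>t::real. f (z + d * of_real t)) has_vector_derivative (a * d + b * cnj d)) (at 0)" for d
  proof -
    have "((\<lambda>t::real. z + d * of_real t) has_derivative (\<lambda>t. d * of_real t)) (at 0)"
      by (auto intro!: derivative_eq_intros)
    from has_derivative_compose[OF this, of f "\<lambda>x. a * x + b * cnj x"] b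
    have "((\<lambda>t. f (z + d * of_real t)) has_derivative (\<lambda>t. a * (d * of_real t) + b * cnj (d * of_real t))) (at 0)"
      by simp
    then show ?thesis
      by (simp add: has_vector_derivative_def scaleR_conv_of_real algebra_simps)
  qed
  from this[of 1] this[of \<i>] show ?thesis
    by (simp add: wirt_def vector_derivative_at algebra_simps)
qed

lemma has_wirt_transform:
  assumes "has_wirt f a z" "open S" "z \<in> S" "\<And>x. x \<in> S \<Longrightarrow> f x = g x"
  shows "has_wirt g a z"
  using assms unfolding has_wirt_def by (meson has_derivative_transform_within_open)

lemma has_wirt_const: "has_wirt (\<lambda>z. c) 0 z"
  unfolding has_wirt_def by (rule exI[of _ 0]) (auto intro!: derivative_eq_intros)

lemma has_wirt_ident: "has_wirt (\<lambda>z. z) 1 z"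
  unfolding has_wirt_def by (rule exI[of _ 0]) (auto intro!: derivative_eq_intros)

lemma has_wirt_cnj: "has_wirt cnj 0 z"
  unfolding has_wirt_def
  by (rule exI[of _ 1]) (auto intro!: bounded_linear_imp_has_derivative bounded_linear_cnj)

lemma has_wirt_add: "has_wirt f a z \<Longrightarrow> has_wirt g b z \<Longrightarrow> has_wirt (\<lambda>z. f z + g z) (a + b) z"
  unfolding has_wirt_def
proof (elim exE)
  fix c d assume "(f has_derivative (\<lambda>x. a * x + c * cnj x)) (at z)"
    "(g has_derivative (\<lambda>x. b * x + d * cnj x)) (at z)"
  then show "\<exists>e. ((\<lambda>z. f z + g z) has_derivative (\<lambda>x. (a + b) * x + e * cnj x)) (at z)"
    by (intro exI[of _ "c + d"]) (auto intro!: derivative_eq_intros simp: algebra_simps)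
qed

lemma has_wirt_mult:
  "has_wirt f a z \<Longrightarrow> has_wirt g b z \<Longrightarrow> has_wirt (\<lambda>z. f z * g z) (f z * b + a * g z) z"
  unfolding has_wirt_def
proof (elim exE)
  fix c d assume "(f has_derivative (\<lambda>x. a * x + c * cnj x)) (at z)"
    "(g has_derivative (\<lambda>x. b * x + d * cnj x)) (at z)"
  then show "\<exists>e. ((\<lambda>z. f z * g z) has_derivative (\<lambda>x. (f z * b + a * g z) * x + e * cnj x)) (at z)"
    by (intro exI[of _ "f z * d + c * g z"]) (auto intro!: derivative_eq_intros simp: algebra_simps)
qed

lemma has_wirt_compose:
  assumes "has_wirt f a z" "(h has_field_derivative d) (at (f z))"
  shows "has_wirt (\<lambda>z. h (f z)) (d * a) z"
proof -
  obtain b where b: "(f has_derivative (\<lambda>x. a * x + b * cnj x)) (at z)"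
    using assms has_wirt_def by auto
  have "((\<lambda>z. h (f z)) has_derivative (\<lambda>x. d * (a * x + b * cnj x))) (at z)"
    using has_derivative_compose[OF b, of h] assms(2) by (simp add: has_field_derivative_def)
  then show ?thesis
    unfolding has_wirt_def by (intro exI[of _ "d * b"]) (simp add: algebra_simps)
qed

lemma has_wirt_sum:
  assumes "\<And>k. k \<in> I \<Longrightarrow> has_wirt (f k) (a k) z"
  shows "has_wirt (\<lambda>z. \<Sum>k\<in>I. f k z) (\<Sum>k\<in>I. a k) z"
  using assms by (induction I rule: infinite_finite_induct) (auto intro: has_wirt_const has_wirt_add)

lemma has_wirt_antiholomorphic:
  assumes "(h has_field_derivative d) (at (cnj z))"
  shows "has_wirt (\<lambda>z. h (cnj z)) 0 z"
  using has_wirt_compose[OF has_wirt_cnj assms] by simp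

text \<open>A derivative at a point depends on the values nearby, so the induction has to carry the
  formula for every iterate on an open set.\<close>

lemma funpow_wirt_eq:
  assumes "open S" "\<And>n z. z \<in> S \<Longrightarrow> has_wirt (\<Phi> n) (\<Phi> (Suc n) z) z"
    and "\<And>z. z \<in> S \<Longrightarrow> f z = \<Phi> 0 z" and "z \<in> S"
  shows "(wirt ^^ n) f z = \<Phi> n z"
  using \<open>z \<in> S\<close>
proof (induction n arbitrary: z)
  case (Suc n)
  then have "has_wirt ((wirt ^^ n) f) (\<Phi> (Suc n) z) z"
    using assms(1,2) has_wirt_transform[of "\<Phi> n" _ z S] by metis
  then show ?case
    by (simp add: has_wirt_imp_wirt)
qed (use assms in auto)

section \<open>Quadratic forms on the disc and their iterated Wirtinger derivatives\<close>

text \<open>These are the complex combinations of the components of the moment map of the Moebius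
  action on the disc.\<close>

definition qform :: "complex \<Rightarrow> complex \<Rightarrow> complex \<Rightarrow> complex \<Rightarrow> complex" where
  "qform A B C z = (A * (1 + z * cnj z) + B * z + C * cnj z) / (1 - z * cnj z)"

text \<open>The unsigned Lah numbers; the recursion is the one that the product rule produces in
  \<open>funpow_wirt_qform\<close>.\<close>

fun lah :: "nat \<Rightarrow> nat \<Rightarrow> nat" where
  "lah 0 0 = 1"
| "lah 0 (Suc k) = 0"
| "lah (Suc n) 0 = n * lah n 0"
| "lah (Suc n) (Suc k) = lah n k + (n + Suc k) * lah n (Suc k)"

lemma lah_eq_0: "n < k \<Longrightarrow> lah n k = 0"
  by (induction n k rule: lah.induct) auto

lemma lah_self: "lah n n = 1"
  by (induction n) (auto simp: lah_eq_0)

lemma one_minus_ne_0: "z \<in> unit_disc \<Longrightarrow> 1 - z * cnj z \<noteq> 0"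
proof -
  assume "z \<in> unit_disc"
  then have "(norm z)\<^sup>2 \<noteq> 1"
    by (simp add: abs_square_eq_1)
  then show ?thesis
    by (metis complex_norm_square eq_iff_diff_eq_0 of_real_eq_1_iff)
qed

text \<open>The numerator of the first derivative contains only \<open>cnj z\<close>, so further
  Wirtinger derivatives treat it as a constant. This keeps all iterates in closed form.\<close>

lemma has_wirt_qform:
  assumes z: "z \<in> unit_disc"
  shows "has_wirt (qform A B C) ((B + 2 * A * cnj z + C * (cnj z)\<^sup>2) * inverse (1 - z * cnj z) ^ 2) z"
    and "has_wirt (\<lambda>z. inverse (1 - z * cnj z)) (cnj z * inverse (1 - z * cnj z) ^ 2) z"
proof -
  note ne = one_minus_ne_0[OF z]
  have "has_wirt (\<lambda>z. 1 + (- 1) * (z * cnj z)) (0 + ((- 1) * (z * 0 + 1 * cnj z) + 0 * (z * cnj z))) z"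
    by (intro has_wirt_add has_wirt_mult has_wirt_const has_wirt_ident has_wirt_cnj)
  then have *: "has_wirt (\<lambda>z. 1 - z * cnj z) (- cnj z) z"
    by simp
  show 1: "has_wirt (\<lambda>z. inverse (1 - z * cnj z)) (cnj z * inverse (1 - z * cnj z) ^ 2) z"
    using has_wirt_compose[OF * DERIV_inverse[OF ne]] by (simp add: numeral_2_eq_2 mult_ac)
  have 2: "has_wirt (\<lambda>z. A * (1 + z * cnj z) + B * z + C * cnj z)
     (A * (0 + (z * 0 + 1 * cnj z)) + 0 * (1 + z * cnj z) + (B * 1 + 0 * z) + (C * 0 + 0 * cnj z)) z"
    by (intro has_wirt_add has_wirt_mult has_wirt_const has_wirt_ident has_wirt_cnj)
  have "(A * (1 + z * cnj z) + B * z + C * cnj z) * (cnj z * inverse (1 - z * cnj z) ^ 2) +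
      (A * cnj z + B) * inverse (1 - z * cnj z)
     = (B + 2 * A * cnj z + C * (cnj z)\<^sup>2) * inverse (1 - z * cnj z) ^ 2"
    using ne by (simp add: divide_simps) (simp add: algebra_simps power2_eq_square)
  then show "has_wirt (qform A B C) ((B + 2 * A * cnj z + C * (cnj z)\<^sup>2) * inverse (1 - z * cnj z) ^ 2) z"
    using has_wirt_mult[OF 2 1] by (simp add: qform_def[abs_def] divide_inverse)
qed

lemma has_field_derivative_higher_deriv:
  assumes "h holomorphic_on UNIV"
  shows "((deriv ^^ n) h has_field_derivative (deriv ^^ Suc n) h x) (at x)"
  using holomorphic_higher_deriv[OF assms open_UNIV, of n]
  by (simp add: holomorphic_derivI)

text \<open>With \<open>x = 1 / (1 - u v)\<close>, \<open>v\<close> the conjugate of \<open>u\<close> and \<open>q = B + 2 A v + C v\<^sup>2\<close>, the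
  derivatives of \<open>qform\<close> and \<open>x\<close> in \<open>u\<close> are \<open>q x\<^sup>2\<close> and \<open>v x\<^sup>2\<close>; only the
  term with \<open>k = n\<close> survives at the origin.\<close>

lemma funpow_wirt_qform:
  assumes h: "h holomorphic_on UNIV" and f: "\<And>u. u \<in> unit_disc \<Longrightarrow> f u = h (qform A B C u)"
  shows "(wirt ^^ n) f 0 = B ^ n * (deriv ^^ n) h A"
proof -
  define q where "q = (\<lambda>v. B + 2 * A * v + C * v\<^sup>2)"
  define x where "x = (\<lambda>u. inverse (1 - u * cnj u))"
  define W where "W = (\<lambda>n k u. q (cnj u) ^ k * cnj u ^ (n - k) * x u ^ (n + k) * (deriv ^^ k) h (qform A B C u))"
  define \<Phi> where "\<Phi> = (\<lambda>n u. \<Sum>k\<le>n. of_nat (lah n k) * W n k u)"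
  have W: "has_wirt (W n k) (W (Suc n) (Suc k) u + of_nat (n + k) * W (Suc n) k u) u"
    if u: "u \<in> unit_disc" and kn: "k \<le> n" for n k u
  proof -
    have 1: "has_wirt (\<lambda>u. q (cnj u) ^ k * cnj u ^ (n - k)) 0 u"
      by (rule has_wirt_antiholomorphic[where d = "deriv (\<lambda>v. q v ^ k * v ^ (n - k)) (cnj u)"])
        (unfold q_def, intro holomorphic_derivI[where S = UNIV] holomorphic_intros, auto)
    have 2: "has_wirt (\<lambda>u. x u ^ (n + k)) (of_nat (n + k) * cnj u * x u ^ (n + k + 1)) u"
    proof -
      have "has_wirt (\<lambda>u. x u ^ (n + k)) (of_nat (n + k) * x u ^ (n + k - 1) * (cnj u * x u ^ 2)) u"
        unfolding x_def
        by (rule has_wirt_compose[OF has_wirt_qform(2)[OF u], of "\<lambda>y. y ^ (n + k)"])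
          (auto intro!: derivative_eq_intros)
      then show ?thesis
        by (cases "n + k") (simp_all add: power2_eq_square mult_ac)
    qed
    have 3: "has_wirt (\<lambda>u. (deriv ^^ k) h (qform A B C u))
        ((deriv ^^ Suc k) h (qform A B C u) * (q (cnj u) * x u ^ 2)) u"
      unfolding q_def x_def
      by (rule has_wirt_compose[OF has_wirt_qform(1)[OF u] has_field_derivative_higher_deriv[OF h]])
    have nk: "Suc n - k = Suc (n - k)"
      using kn by simp
    have "W n k = (\<lambda>u. (q (cnj u) ^ k * cnj u ^ (n - k)) * x u ^ (n + k) * (deriv ^^ k) h (qform A B C u))"
      by (simp add: W_def fun_eq_iff)
    moreover have "(q (cnj u) ^ k * cnj u ^ (n - k)) * x u ^ (n + k) *
          ((deriv ^^ Suc k) h (qform A B C u) * (q (cnj u) * x u ^ 2)) +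
        ((q (cnj u) ^ k * cnj u ^ (n - k)) * (of_nat (n + k) * cnj u * x u ^ (n + k + 1)) + 0 * x u ^ (n + k)) *
          (deriv ^^ k) h (qform A B C u)
        = W (Suc n) (Suc k) u + of_nat (n + k) * W (Suc n) k u"
      by (simp add: W_def nk power2_eq_square del: of_nat_add funpow.simps)
    ultimately show ?thesis
      using has_wirt_mult[OF has_wirt_mult[OF 1 2] 3] by metis
  qed
  have "has_wirt (\<Phi> n) (\<Phi> (Suc n) u) u" if u: "u \<in> unit_disc" for n u
  proof -
    have "has_wirt (\<Phi> n) (\<Sum>k\<le>n. of_nat (lah n k) * (W (Suc n) (Suc k) u + of_nat (n + k) * W (Suc n) k u) + 0 * W n k u) u"
      unfolding \<Phi>_def by (intro has_wirt_sum has_wirt_mult has_wirt_const W u) auto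
    moreover have "(\<Sum>k\<le>n. of_nat (lah n k) * (W (Suc n) (Suc k) u + of_nat (n + k) * W (Suc n) k u) + 0 * W n k u)
        = \<Phi> (Suc n) u"
    proof -
      let ?V = "\<lambda>k. of_nat ((n + k) * lah n k) * W (Suc n) k u"
      \<comment> \<open>The added summand is zero because \<open>lah n (Suc n)\<close> is; after the
        index shift the two sums combine by the recursion of \<open>lah\<close>.\<close>
      have "(\<Sum>k\<le>n. ?V k) = (\<Sum>k\<le>Suc n. ?V k)"
        by (simp add: lah_eq_0)
      also have "\<dots> = ?V 0 + (\<Sum>k\<le>n. ?V (Suc k))"
        by (rule sum.atMost_Suc_shift)
      finally have "(\<Sum>k\<le>n. of_nat (lah n k) * W (Suc n) (Suc k) u) + (\<Sum>k\<le>n. ?V k)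
         = ?V 0 + (\<Sum>k\<le>n. of_nat (lah n k) * W (Suc n) (Suc k) u + ?V (Suc k))"
        by (simp add: sum.distrib)
      also have "\<dots> = of_nat (lah (Suc n) 0) * W (Suc n) 0 u
          + (\<Sum>k\<le>n. of_nat (lah (Suc n) (Suc k)) * W (Suc n) (Suc k) u)"
        by (simp add: algebra_simps)
      also have "\<dots> = \<Phi> (Suc n) u"
        unfolding \<Phi>_def by (rule sum.atMost_Suc_shift[symmetric])
      finally show ?thesis
        by (simp add: sum.distrib algebra_simps)
    qed
    ultimately show ?thesis
      by simp
  qed
  then have "(wirt ^^ n) f 0 = \<Phi> n 0"
    by (intro funpow_wirt_eq[of unit_disc]) (auto simp: f \<Phi>_def W_def)
  also have "\<dots> = (\<Sum>k\<le>n. if k = n then q 0 ^ n * (deriv ^^ n) h A else 0)"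
    unfolding \<Phi>_def
    by (intro sum.cong) (auto simp: W_def x_def lah_self qform_def)
  finally show ?thesis
    by (simp add: q_def)
qed

lemma higher_deriv_cnj_cnj:
  assumes "h holomorphic_on UNIV"
  shows "(deriv ^^ n) (\<lambda>x. cnj (h (cnj x))) x = cnj ((deriv ^^ n) h (cnj x))"
proof (induction n arbitrary: x)
  case (Suc n)
  have "((\<lambda>x. cnj ((deriv ^^ n) h (cnj x))) has_field_derivative cnj ((deriv ^^ Suc n) h (cnj x))) (at x)"
    using has_field_derivative_cnj_cnj[of "(deriv ^^ n) h" _ x]
      has_field_derivative_higher_deriv[OF assms, of n "cnj x"] by (simp add: o_def)
  then have "deriv (\<lambda>x. cnj ((deriv ^^ n) h (cnj x))) x = cnj ((deriv ^^ Suc n) h (cnj x))"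
    by (rule DERIV_imp_deriv)
  moreover have "(deriv ^^ n) (\<lambda>x. cnj (h (cnj x))) = (\<lambda>x. cnj ((deriv ^^ n) h (cnj x)))"
    using Suc by blast
  ultimately show ?case
    by simp
qed auto

section \<open>Moebius covariance and star products of functions of one form\<close>

lemma Tmob_in_disc:
  assumes "z \<in> unit_disc" "u \<in> unit_disc"
  shows "Tmob z u \<in> unit_disc" "1 + cnj z * u \<noteq> 0"
proof -
  have "(norm (1 + cnj z * u))\<^sup>2 - (norm (z + u))\<^sup>2 = (1 - (norm z)\<^sup>2) * (1 - (norm u)\<^sup>2)"
    unfolding cmod_power2 by (simp add: power2_eq_square algebra_simps)
  moreover have "(norm z)\<^sup>2 < 1" "(norm u)\<^sup>2 < 1"
    using assms by (auto simp: abs_square_less_1)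
  ultimately have "(norm (z + u))\<^sup>2 < (norm (1 + cnj z * u))\<^sup>2"
    by (metis diff_gt_0_iff_gt zero_less_mult_iff)
  then have lt: "norm (z + u) < norm (1 + cnj z * u)"
    using norm_ge_zero power2_less_imp_less by blast
  then show ne: "1 + cnj z * u \<noteq> 0"
    using norm_ge_zero[of "z + u"] by auto
  then show "Tmob z u \<in> unit_disc"
    using lt by (simp add: Tmob_def norm_divide)
qed

text \<open>The forms are permuted by the automorphisms of the disc, so Peschl-Minda derivatives at
  \<open>z\<close> become derivatives of another form at the origin. Its coefficients are the value
  and the two first-order derivatives of the old form at \<open>z\<close>.\<close>

lemma qform_Tmob:
  assumes z: "z \<in> unit_disc" and u: "u \<in> unit_disc"
  shows "qform A B C (Tmob z u) =
    qform (qform A B C z) ((B + 2 * A * cnj z + C * (cnj z)\<^sup>2) / (1 - z * cnj z))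
      ((C + 2 * A * z + B * z\<^sup>2) / (1 - z * cnj z)) u"
proof -
  define zc uc where "zc = cnj z" and "uc = cnj u"
  have d: "1 + zc * u \<noteq> 0" "1 + z * uc \<noteq> 0"
    using Tmob_in_disc(2)[OF z u] complex_cnj_zero_iff[of "1 + cnj z * u"] by (simp_all add: zc_def uc_def)
  have T: "Tmob z u = (z + u) / (1 + zc * u)" "cnj (Tmob z u) = (zc + uc) / (1 + z * uc)"
    by (auto simp: Tmob_def zc_def uc_def)
  \<comment> \<open>Multiplying by \<open>D\<close> clears the denominators of
    \<open>Tmob z u\<close> and its conjugate together; the conjugates \<open>zc\<close> and
    \<open>uc\<close> act as independent variables.\<close>
  define D where "D = (1 + zc * u) * (1 + z * uc)"
  have D: "D \<noteq> 0"
    using d by (simp add: D_def)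
  define X Y where "X = 1 + zc * u" and "Y = 1 + z * uc"
  have "D = X * Y" "X \<noteq> 0" "Y \<noteq> 0" "Tmob z u = (z + u) / X" "cnj (Tmob z u) = (zc + uc) / Y"
    using d T by (simp_all add: D_def X_def Y_def)
  then have P: "D * (Tmob z u * cnj (Tmob z u)) = (z + u) * (zc + uc)"
      "D * Tmob z u = (z + u) * Y" "D * cnj (Tmob z u) = (zc + uc) * X"
    by simp_all
  have 1: "D * (1 - Tmob z u * cnj (Tmob z u)) = (1 - z * zc) * (1 - u * uc)"
    unfolding right_diff_distrib P by (simp add: D_def algebra_simps)
  have "D * (A * (1 + Tmob z u * cnj (Tmob z u)) + B * Tmob z u + C * cnj (Tmob z u))
     = A * (D + D * (Tmob z u * cnj (Tmob z u))) + B * (D * Tmob z u) + C * (D * cnj (Tmob z u))"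
    by (simp add: algebra_simps)
  then have 2: "D * (A * (1 + Tmob z u * cnj (Tmob z u)) + B * Tmob z u + C * cnj (Tmob z u))
     = A * (D + (z + u) * (zc + uc)) + B * ((z + u) * (1 + z * uc)) + C * ((zc + uc) * (1 + zc * u))"
    unfolding P X_def Y_def .
  have "qform A B C (Tmob z u) = (D * (A * (1 + Tmob z u * cnj (Tmob z u)) + B * Tmob z u + C * cnj (Tmob z u)))
     / (D * (1 - Tmob z u * cnj (Tmob z u)))"
    unfolding qform_def using D by simp
  also have "\<dots> = ((A * (1 + z * zc) + B * z + C * zc) * (1 + u * uc) + (B + 2 * A * zc + C * zc\<^sup>2) * u +
       (C + 2 * A * z + B * z\<^sup>2) * uc) / ((1 - z * zc) * (1 - u * uc))"
    unfolding 1 2 unfolding D_def by (simp add: algebra_simps power2_eq_square)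
  also have "\<dots> = ((A * (1 + z * zc) + B * z + C * zc) / (1 - z * zc) * (1 + u * uc) +
       (B + 2 * A * zc + C * zc\<^sup>2) / (1 - z * zc) * u +
       (C + 2 * A * z + B * z\<^sup>2) / (1 - z * zc) * uc) / (1 - u * uc)"
    by (simp only: divide_inverse inverse_mult_distrib) (simp only: algebra_simps)
  finally show ?thesis
    by (simp add: qform_def zc_def uc_def)
qed

lemma PM_qform:
  assumes h: "h holomorphic_on UNIV" and f: "\<And>z. z \<in> unit_disc \<Longrightarrow> f z = h (qform A B C z)"
    and z: "z \<in> unit_disc"
  shows "PM n f z = ((B + 2 * A * cnj z + C * (cnj z)\<^sup>2) / (1 - z * cnj z)) ^ n * (deriv ^^ n) h (qform A B C z)"
  unfolding PM_def
proof (rule funpow_wirt_qform[OF h])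
  fix u :: complex assume "u \<in> unit_disc"
  then show "f (Tmob z u) = h (qform (qform A B C z) ((B + 2 * A * cnj z + C * (cnj z)\<^sup>2) / (1 - z * cnj z))
      ((C + 2 * A * z + B * z\<^sup>2) / (1 - z * cnj z)) u)"
    using f Tmob_in_disc(1) qform_Tmob z by metis
qed

lemma cnj_qform: "cnj (qform A B C z) = qform (cnj A) (cnj C) (cnj B) z"
  by (simp add: qform_def algebra_simps)

lemma PMbar_qform:
  assumes h: "h holomorphic_on UNIV" and f: "\<And>z. z \<in> unit_disc \<Longrightarrow> f z = h (qform A B C z)"
    and z: "z \<in> unit_disc"
  shows "PMbar n f z = ((C + 2 * A * z + B * z\<^sup>2) / (1 - z * cnj z)) ^ n * (deriv ^^ n) h (qform A B C z)"
proof -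
  have "(cnj \<circ> h \<circ> cnj) holomorphic_on UNIV"
    using holomorphic_on_compose_cnj_cnj[of h UNIV] h holomorphic_on_subset by blast
  then have h': "(\<lambda>x. cnj (h (cnj x))) holomorphic_on UNIV"
    by (simp add: o_def)
  have "PM n (\<lambda>x. cnj (f x)) z =
      ((cnj C + 2 * cnj A * cnj z + cnj B * (cnj z)\<^sup>2) / (1 - z * cnj z)) ^ n *
      (deriv ^^ n) (\<lambda>x. cnj (h (cnj x))) (qform (cnj A) (cnj C) (cnj B) z)"
    using f z by (intro PM_qform h') (auto simp flip: cnj_qform)
  then show ?thesis
    unfolding PMbar_def by (simp add: higher_deriv_cnj_cnj[OF h] flip: cnj_qform) (simp add: mult_ac)
qed

text \<open>A^2 - B C is invariant under the change of coefficients in \<open>qform_Tmob\<close>;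
  here the invariance is solved for the product of the two new outer coefficients.\<close>

lemma qform_casimir:
  assumes "z \<in> unit_disc"
  shows "(C + 2 * A * z + B * z\<^sup>2) / (1 - z * cnj z) * ((B + 2 * A * cnj z + C * (cnj z)\<^sup>2) / (1 - z * cnj z))
    = (qform A B C z)\<^sup>2 - (A\<^sup>2 - B * C)"
  using one_minus_ne_0[OF assms] unfolding qform_def
  by (simp add: divide_simps) (simp add: algebra_simps power2_eq_square)

text \<open>By the Casimir identity the two first-order factors combine into a power of
  \<open>K\<close>, so the product depends on \<open>z\<close> only through the value of the
  form.\<close>

lemma star_D_qform:
  assumes h: "h holomorphic_on UNIV" and f: "\<And>z. z \<in> unit_disc \<Longrightarrow> f z = h (qform A B C z)"
    and k: "k holomorphic_on UNIV" and g: "\<And>z. z \<in> unit_disc \<Longrightarrow> g z = k (qform A B C z)"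
    and z: "z \<in> unit_disc" and K: "K = (qform A B C z)\<^sup>2 - (A\<^sup>2 - B * C)"
  shows "star_D t f g z =
    (\<Sum>n. cc t n / fact n * K ^ n * (deriv ^^ n) h (qform A B C z) * (deriv ^^ n) k (qform A B C z))"
proof -
  have "K ^ n = ((C + 2 * A * z + B * z\<^sup>2) / (1 - z * cnj z)) ^ n * ((B + 2 * A * cnj z + C * (cnj z)\<^sup>2) / (1 - z * cnj z)) ^ n" for n
    unfolding K qform_casimir[OF z, symmetric] by (rule power_mult_distrib)
  then show ?thesis
    unfolding star_D_def using z PM_qform[OF k g z] PMbar_qform[OF h f z]
    by (simp only: if_True) (simp only: mult_ac)
qed

lemma higher_deriv_one: "(deriv ^^ n) (\<lambda>x::complex. 1) = (\<lambda>x. if n = 0 then 1 else 0)"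
  by (induction n) auto

text \<open>The identity has no derivatives beyond the first, so the series stops after the terms
  with \<open>cc t 0 = 1\<close> and \<open>cc t 1 = t\<close>.\<close>

lemma star_D_qform_ident:
  assumes f: "\<And>z. z \<in> unit_disc \<Longrightarrow> f z = qform A B C z" and z: "z \<in> unit_disc"
  shows "star_D t f f z = (f z)\<^sup>2 + t * ((f z)\<^sup>2 - (A\<^sup>2 - B * C))"
proof -
  let ?K = "(qform A B C z)\<^sup>2 - (A\<^sup>2 - B * C)"
  have d1: "deriv (\<lambda>x::complex. x) = (\<lambda>x. 1)"
    by (simp add: fun_eq_iff)
  have d: "(deriv ^^ n) (\<lambda>x::complex. x) = (\<lambda>x. if n = 0 then x else if n = 1 then 1 else 0)" for n
    by (cases n) (auto simp: funpow_Suc_right d1 higher_deriv_one simp del: funpow.simps)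
  have "star_D t f f z = (\<Sum>n. cc t n / fact n * ?K ^ n * (deriv ^^ n) (\<lambda>x. x) (qform A B C z) * (deriv ^^ n) (\<lambda>x. x) (qform A B C z))"
    by (rule star_D_qform) (use f z in \<open>auto intro: holomorphic_intros\<close>)
  also have "\<dots> = (\<Sum>n\<in>{0,1}. cc t n / fact n * ?K ^ n * (deriv ^^ n) (\<lambda>x. x) (qform A B C z) * (deriv ^^ n) (\<lambda>x. x) (qform A B C z))"
    by (rule suminf_finite) (auto simp: d)
  finally show ?thesis
    using f z by (simp add: d cc_def power2_eq_square)
qed

lemma star_D_one_right:
  assumes g: "\<And>z. z \<in> unit_disc \<Longrightarrow> g z = 1" and z: "z \<in> unit_disc"
  shows "star_D t f g z = f z"
proof -
  have PM: "PM n g z = (if n = 0 then 1 else 0)" for n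
    using PM_qform[of "\<lambda>x. 1" g 0 0 0 z n] g z by (simp add: higher_deriv_one)
  have "PMbar 0 f z = f z"
    by (simp add: PMbar_def PM_def Tmob_def)
  moreover have "star_D t f g z = (\<Sum>n\<in>{0}. cc t n / fact n * PMbar n f z * PM n g z)"
    using z unfolding star_D_def by (simp only: if_True) (rule suminf_finite, auto simp: PM)
  ultimately show ?thesis
    by (simp add: PM cc_def)
qed

lemma star_D_one_left:
  assumes f: "\<And>z. z \<in> unit_disc \<Longrightarrow> f z = 1" and z: "z \<in> unit_disc"
  shows "star_D t f g z = g z"
proof -
  have PM: "PMbar n f z = (if n = 0 then 1 else 0)" for n
    using PMbar_qform[of "\<lambda>x. 1" f 0 0 0 z n] f z by (simp add: higher_deriv_one)
  have "PM 0 g z = g z"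
    by (simp add: PM_def Tmob_def)
  moreover have "star_D t f g z = (\<Sum>n\<in>{0}. cc t n / fact n * PMbar n f z * PM n g z)"
    using z unfolding star_D_def by (simp only: if_True) (rule suminf_finite, auto simp: PM)
  ultimately show ?thesis
    by (simp add: PM cc_def)
qed

section \<open>Functions on the complexified disc\<close>

definition cdiff2 :: "(complex \<times> complex \<Rightarrow> complex) \<Rightarrow> complex \<times> complex \<Rightarrow> bool" where
  "cdiff2 G p \<longleftrightarrow> (\<exists>L. (G has_derivative L) (at p) \<and> (\<forall>v. L (\<i> * fst v, \<i> * snd v) = \<i> * L v))"

lemma holo2_iff_cdiff2: "holo2 G U \<longleftrightarrow> (\<forall>p\<in>U. cdiff2 G p)"
  by (simp add: holo2_def cdiff2_def)

lemma cdiff2_const: "cdiff2 (\<lambda>p. c) p"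
  unfolding cdiff2_def by (intro exI[of _ "\<lambda>v. 0"]) (auto intro!: derivative_eq_intros)

lemma cdiff2_fst: "cdiff2 fst p"
  unfolding cdiff2_def by (intro exI[of _ fst]) (auto intro!: derivative_eq_intros)

lemma cdiff2_snd: "cdiff2 snd p"
  unfolding cdiff2_def by (intro exI[of _ snd]) (auto intro!: derivative_eq_intros)

lemma cdiff2_add: "cdiff2 G p \<Longrightarrow> cdiff2 H p \<Longrightarrow> cdiff2 (\<lambda>p. G p + H p) p"
  unfolding cdiff2_def
proof (elim exE conjE)
  fix L M assume "(G has_derivative L) (at p)" "(H has_derivative M) (at p)"
    "\<forall>v. L (\<i> * fst v, \<i> * snd v) = \<i> * L v" "\<forall>v. M (\<i> * fst v, \<i> * snd v) = \<i> * M v"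
  then show "\<exists>N. ((\<lambda>p. G p + H p) has_derivative N) (at p) \<and> (\<forall>v. N (\<i> * fst v, \<i> * snd v) = \<i> * N v)"
    by (intro exI[of _ "\<lambda>v. L v + M v"]) (auto intro!: derivative_eq_intros simp: algebra_simps)
qed

lemma cdiff2_mult: "cdiff2 G p \<Longrightarrow> cdiff2 H p \<Longrightarrow> cdiff2 (\<lambda>p. G p * H p) p"
  unfolding cdiff2_def
proof (elim exE conjE)
  fix L M assume "(G has_derivative L) (at p)" "(H has_derivative M) (at p)"
    "\<forall>v. L (\<i> * fst v, \<i> * snd v) = \<i> * L v" "\<forall>v. M (\<i> * fst v, \<i> * snd v) = \<i> * M v"
  then show "\<exists>N. ((\<lambda>p. G p * H p) has_derivative N) (at p) \<and> (\<forall>v. N (\<i> * fst v, \<i> * snd v) = \<i> * N v)"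
    by (intro exI[of _ "\<lambda>v. G p * M v + L v * H p"]) (auto intro!: derivative_eq_intros simp: algebra_simps)
qed

lemma cdiff2_compose:
  assumes "cdiff2 G p" "(k has_field_derivative d) (at (G p))"
  shows "cdiff2 (\<lambda>p. k (G p)) p"
proof -
  obtain L where L: "(G has_derivative L) (at p)" "\<forall>v. L (\<i> * fst v, \<i> * snd v) = \<i> * L v"
    using assms cdiff2_def by auto
  have "((\<lambda>p. k (G p)) has_derivative (\<lambda>v. d * L v)) (at p)"
    using has_derivative_compose[OF L(1), of k] assms(2) by (simp add: has_field_derivative_def)
  then show ?thesis
    unfolding cdiff2_def by (intro exI[of _ "\<lambda>v. d * L v"]) (auto simp: L(2))
qed

lemma cdiff2_divide:
  assumes "cdiff2 G p" "cdiff2 H p" "H p \<noteq> 0"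
  shows "cdiff2 (\<lambda>p. G p / H p) p"
  unfolding divide_inverse
  by (intro cdiff2_mult cdiff2_compose[OF assms(2) DERIV_inverse] assms)

lemma cdiff2_transform:
  assumes "cdiff2 G p" "open U" "p \<in> U" "\<And>q. q \<in> U \<Longrightarrow> G q = H q"
  shows "cdiff2 H p"
  using assms unfolding cdiff2_def by (meson has_derivative_transform_within_open)

text \<open>The clauses with \<open>None\<close> are the limits of the first one as coordinates tend
  to infinity. The denominators vanish exactly at the pairs removed from
  \<open>Omega\<close>.\<close>

fun qform_ext :: "complex \<Rightarrow> complex \<Rightarrow> complex \<Rightarrow> complex option \<times> complex option \<Rightarrow> complex" where
  "qform_ext A B C (Some z, Some w) = (A * (1 + z * w) + B * z + C * w) / (1 - z * w)"
| "qform_ext A B C (None, Some w) = - (A * w + B) / w"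
| "qform_ext A B C (Some z, None) = - (A * z + C) / z"
| "qform_ext A B C (None, None) = - A"

lemma mem_Omega_iff:
  "(Some z, Some w) \<in> Omega \<longleftrightarrow> z * w \<noteq> 1" "(None, Some w) \<in> Omega \<longleftrightarrow> w \<noteq> 0"
  "(Some z, None) \<in> Omega \<longleftrightarrow> z \<noteq> 0" "(None, None) \<in> Omega"
  by (auto simp: Omega_def)

text \<open>In a mixed chart the curve z w = 1 becomes the diagonal u = v without its origin, and
  the origin is the removed pair at infinity; so one inequality covers both.\<close>

lemma chart_dom_iff:
  "(u, v) \<in> chart_dom a b \<longleftrightarrow> (if a = b then 1 - u * v \<noteq> 0 else u - v \<noteq> 0)"
  by (cases a; cases b; cases "u = 0"; cases "v = 0")
    (auto simp: chart_dom_def mem_Omega_iff chart_def)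

lemma qform_ext_chart:
  assumes "p \<in> chart_dom a b"
  shows "qform_ext A B C (chart a (fst p), chart b (snd p)) =
   (if a then if b then - (A * (1 + fst p * snd p) + B * snd p + C * fst p) / (1 - fst p * snd p)
               else (A * (fst p + snd p) + B + C * (fst p * snd p)) / (fst p - snd p)
    else if b then - (A * (fst p + snd p) + B * (fst p * snd p) + C) / (fst p - snd p)
         else (A * (1 + fst p * snd p) + B * fst p + C * snd p) / (1 - fst p * snd p))"
proof -
  obtain u v where p: "p = (u, v)" by force
  have "(u, v) \<in> chart_dom a b" using assms p by simp
  then show ?thesis
    unfolding p chart_dom_iff chart_def
    by (cases a; cases b; cases "u = 0"; cases "v = 0") (simp_all add: divide_simps, auto simp: algebra_simps)
qed

lemma open_chart_dom: "open (chart_dom a b)"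
proof -
  have "chart_dom a b = {p. if a = b then 1 - fst p * snd p \<noteq> 0 else fst p - snd p \<noteq> 0}"
  proof (rule set_eqI)
    fix p :: "complex \<times> complex"
    show "p \<in> chart_dom a b \<longleftrightarrow> p \<in> {p. if a = b then 1 - fst p * snd p \<noteq> 0 else fst p - snd p \<noteq> 0}"
      using chart_dom_iff[of "fst p" "snd p" a b] by (simp only: prod.collapse mem_Collect_eq)
  qed
  moreover have "open {p :: complex \<times> complex. 1 - fst p * snd p \<noteq> 0}" "open {p :: complex \<times> complex. fst p - snd p \<noteq> 0}"
    by (intro open_Collect_neq continuous_intros)+
  ultimately show ?thesis
    by (cases "a = b") simp_all
qed

lemma holo_Omega_qform_ext:
  assumes k: "k holomorphic_on UNIV"
  shows "holo_Omega (\<lambda>p. k (qform_ext A B C p))"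
  unfolding holo_Omega_def holo2_iff_cdiff2
proof (intro allI ballI)
  fix a b p assume p: "p \<in> chart_dom a b"
  have dom: "if a = b then 1 - fst p * snd p \<noteq> 0 else fst p - snd p \<noteq> 0"
    using p chart_dom_iff[of "fst p" "snd p" a b] by simp
  \<comment> \<open>Up to a sign and an exchange of \<open>B\<close> and \<open>C\<close>, both
    governed by \<open>b\<close>, the four chart expressions are only two, selected by
    \<open>e\<close>.\<close>
  define e where "e \<longleftrightarrow> a = b"
  define N where "N = (\<lambda>A B C p. if e then A * (1 + fst p * snd p) + B * fst p + C * snd p
      else A * (fst p + snd p) + B + C * (fst p * snd p :: complex))"
  define D where "D = (\<lambda>p. if e then 1 + (- 1) * (fst p * snd p) else fst p + (- 1) * snd p :: complex)"
  have "cdiff2 (N A B C) p" for A B C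
    unfolding N_def
    by (cases e; simp only: if_True if_False; intro cdiff2_add cdiff2_mult cdiff2_const cdiff2_fst cdiff2_snd)
  moreover have "cdiff2 D p"
    unfolding D_def
    by (cases e; simp only: if_True if_False; intro cdiff2_add cdiff2_mult cdiff2_const cdiff2_fst cdiff2_snd)
  moreover have "D p \<noteq> 0"
    using dom by (simp add: D_def e_def split: if_splits)
  ultimately have "cdiff2 (\<lambda>p. N A B C p / D p) p" for A B C
    by (rule cdiff2_divide)
  moreover have "(k has_field_derivative deriv k x) (at x)" for x
    using k by (simp add: holomorphic_derivI)
  ultimately have *: "cdiff2 (\<lambda>p. k (N A B C p / D p)) p" for A B C
    by (rule cdiff2_compose)
  have "qform_ext A B C (chart a (fst q), chart b (snd q)) =
      (if b then N (- A) (- C) (- B) q / D q else N A B C q / D q)" if "q \<in> chart_dom a b" for q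
  proof -
    have "- (A * (1 + x) + B * v + C * u) = - A * (1 + x) + - C * u + - B * v"
      "- (A * y + B * x + C) = - A * y + - C + - B * x"
      "1 - x = 1 + - 1 * x" "u - v = u + - 1 * v" for x y u v :: complex
      by simp_all
    then show ?thesis
      unfolding qform_ext_chart[OF that] N_def D_def e_def
      by (cases a; cases b; simp only: if_True if_False simp_thms)
  qed
  note ext = this
  have "cdiff2 (\<lambda>q. k (qform_ext A B C (chart a (fst q), chart b (snd q)))) p"
  proof (cases b)
    case True
    show ?thesis
      by (rule cdiff2_transform[OF *[of "- A" "- C" "- B"] open_chart_dom p]) (subst ext, assumption, simp only: True if_True)
  next
    case False
    show ?thesis
      by (rule cdiff2_transform[OF *[of A B C] open_chart_dom p]) (subst ext, assumption, simp only: False if_False)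
  qed
  then show "cdiff2 (\<lambda>(u, v). k (qform_ext A B C (chart a u, chart b v))) p"
    by (simp only: case_prod_unfold)
qed

lemma A_D_qform:
  assumes k: "k holomorphic_on UNIV" and f: "\<And>z. z \<in> unit_disc \<Longrightarrow> f z = k (qform A B C z)"
    and f0: "\<And>z. z \<notin> unit_disc \<Longrightarrow> f z = 0"
  shows "f \<in> A_D"
proof -
  have "represents (\<lambda>p. k (qform_ext A B C p)) f"
    unfolding represents_def using holo_Omega_qform_ext[OF k] f by (simp add: qform_def)
  then show ?thesis
    using f0 by (auto simp: A_D_def)
qed

section \<open>Holomorphic curves in the complexification\<close>

text \<open>The point of the sphere with homogeneous coordinates \<open>n\<close> and
  \<open>d\<close>. The meaningless pair 0, 0 also goes to \<open>None\<close>; the inequality in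
  \<open>ratio_mem_Omega\<close> excludes it.\<close>

definition ratio :: "complex \<Rightarrow> complex \<Rightarrow> complex option" where
  "ratio n d = (if d = 0 then None else Some (n / d))"

lemma complex_linear_combination:
  assumes L: "bounded_linear L" and i: "\<And>v. L (\<i> * fst v, \<i> * snd v) = \<i> * (L v :: complex)"
  shows "L (x * u, x * v) = x * L (u, v)"
proof -
  interpret bounded_linear L by fact
  have "(x * u, x * v) = Re x *\<^sub>R (u, v) + Im x *\<^sub>R (\<i> * u, \<i> * v)"
    by (simp add: complex_eq_iff)
  then have "L (x * u, x * v) = Re x *\<^sub>R L (u, v) + Im x *\<^sub>R (\<i> * L (u, v))"
    using i[of "(u, v)"] by (simp only: add scaleR fst_conv snd_conv)
  also have "\<dots> = x * L (u, v)"
    by (simp add: complex_eq_iff algebra_simps)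
  finally show ?thesis .
qed

lemma cdiff2_along_curve:
  assumes G: "cdiff2 G (u t, v t)" and u: "(u has_field_derivative u') (at t)"
    and v: "(v has_field_derivative v') (at t)"
  shows "(\<lambda>s. G (u s, v s)) field_differentiable (at t)"
proof -
  obtain L where L: "(G has_derivative L) (at (u t, v t))" "\<And>v. L (\<i> * fst v, \<i> * snd v) = \<i> * L v"
    using G unfolding cdiff2_def by blast
  have "(u has_derivative (\<lambda>x. x * u')) (at t)" "(v has_derivative (\<lambda>x. x * v')) (at t)"
    using u v by (simp_all add: has_field_derivative_def mult_commute_abs)
  then have "((\<lambda>s. (u s, v s)) has_derivative (\<lambda>x. (x * u', x * v'))) (at t)"
    by (rule has_derivative_Pair)
  from has_derivative_compose[OF this L(1)]
  have *: "((\<lambda>s. G (u s, v s)) has_derivative (\<lambda>x. L (x * u', x * v'))) (at t)" .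
  have "bounded_linear L"
    using L(1) by (rule has_derivative_bounded_linear)
  then have lin: "L (x * u', x * v') = x * L (u', v')" for x
    by (rule complex_linear_combination) (rule L(2))
  have "(\<lambda>x. L (x * u', x * v')) = (*) (L (u', v'))"
    unfolding lin by (rule ext) (rule mult.commute)
  with * have "((\<lambda>s. G (u s, v s)) has_field_derivative L (u', v')) (at t)"
    by (simp add: has_field_derivative_def)
  then show ?thesis
    by (auto simp: field_differentiable_def)
qed

lemma ratio_mem_Omega: "n1 * n2 \<noteq> d1 * d2 \<Longrightarrow> (ratio n1 d1, ratio n2 d2) \<in> Omega"
  by (cases "d1 = 0"; cases "d2 = 0") (auto simp: ratio_def mem_Omega_iff times_divide_times_eq)

text \<open>Holomorphic curves in \<open>Omega\<close> are given in homogeneous coordinates, so that a single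
  inequality both keeps each point of the sphere well defined and avoids the removed diagonal.\<close>

lemma holo_Omega_along_curve:
  assumes F: "holo_Omega F" and S: "open S"
    and hol: "n1 holomorphic_on S" "d1 holomorphic_on S" "n2 holomorphic_on S" "d2 holomorphic_on S"
    and ne: "\<And>t. t \<in> S \<Longrightarrow> n1 t * n2 t \<noteq> d1 t * d2 t"
  shows "(\<lambda>t. F (ratio (n1 t) (d1 t), ratio (n2 t) (d2 t))) holomorphic_on S"
  unfolding holomorphic_on_open[OF S] field_differentiable_def[symmetric]
proof (intro ballI)
  \<comment> \<open>Where \<open>n\<close> and \<open>d\<close> do not both vanish, one of them
    stays non-zero nearby, and dividing by it gives a holomorphic local coordinate in one of the two
    charts.\<close>
  have loc: "\<exists>U u a. open U \<and> t \<in> U \<and> U \<subseteq> S \<and> u holomorphic_on U \<and>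
      (\<forall>s\<in>U. chart a (u s) = ratio (n s) (d s))"
    if t: "t \<in> S" and nd: "n t \<noteq> 0 \<or> d t \<noteq> 0" and n: "n holomorphic_on S" and d: "d holomorphic_on S"
    for n d t
  proof (cases "d t = 0")
    case True
    let ?U = "S \<inter> n -` (- {0})"
    have "open ?U"
      using holomorphic_on_imp_continuous_on[OF n] S by (intro continuous_open_preimage) auto
    moreover have "(\<lambda>s. d s / n s) holomorphic_on ?U"
      using n d by (intro holomorphic_intros) (auto intro: holomorphic_on_subset)
    ultimately show ?thesis
      using t nd True
      by (intro exI[of _ ?U] exI[of _ "\<lambda>s. d s / n s"] exI[of _ True]) (auto simp: chart_def ratio_def)
  next
    case False
    let ?U = "S \<inter> d -` (- {0})"
    have "open ?U"
      using holomorphic_on_imp_continuous_on[OF d] S by (intro continuous_open_preimage) auto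
    moreover have "(\<lambda>s. n s / d s) holomorphic_on ?U"
      using n d by (intro holomorphic_intros) (auto intro: holomorphic_on_subset)
    ultimately show ?thesis
      using t False
      by (intro exI[of _ ?U] exI[of _ "\<lambda>s. n s / d s"] exI[of _ False]) (auto simp: chart_def ratio_def)
  qed
  fix t assume t: "t \<in> S"
  have "n1 t \<noteq> 0 \<or> d1 t \<noteq> 0" "n2 t \<noteq> 0 \<or> d2 t \<noteq> 0"
    using ne[OF t] by auto
  note nz = this
  obtain U u a where U: "open U" "t \<in> U" "U \<subseteq> S" "u holomorphic_on U"
      "\<And>s. s \<in> U \<Longrightarrow> chart a (u s) = ratio (n1 s) (d1 s)"
    using loc[OF t nz(1) hol(1,2)] by blast
  obtain V v b where V: "open V" "t \<in> V" "v holomorphic_on V"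
      "\<And>s. s \<in> V \<Longrightarrow> chart b (v s) = ratio (n2 s) (d2 s)"
    using loc[OF t nz(2) hol(3,4)] by blast
  have "(u t, v t) \<in> chart_dom a b"
    using ratio_mem_Omega[OF ne[OF t]] U V by (simp add: chart_dom_def)
  then have "cdiff2 (\<lambda>(u, v). F (chart a u, chart b v)) (u t, v t)"
    using F by (auto simp: holo_Omega_def holo2_iff_cdiff2)
  then have "(\<lambda>s. case (u s, v s) of (u, v) \<Rightarrow> F (chart a u, chart b v)) field_differentiable at t"
    by (rule cdiff2_along_curve[OF _ holomorphic_derivI[OF U(4,1,2)] holomorphic_derivI[OF V(3,1,2)]])
  then obtain d where "((\<lambda>s. F (chart a (u s), chart b (v s))) has_field_derivative d) (at t)"
    by (auto simp: field_differentiable_def)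
  then have "((\<lambda>t. F (ratio (n1 t) (d1 t), ratio (n2 t) (d2 t))) has_field_derivative d) (at t)"
    by (rule has_field_derivative_transform_within_open[where S = "U \<inter> V"]) (use U V in auto)
  then show "(\<lambda>t. F (ratio (n1 t) (d1 t), ratio (n2 t) (d2 t))) field_differentiable at t"
    by (auto simp: field_differentiable_def)
qed

text \<open>As \<open>n \<rightarrow> \<infinity>\<close>, periodicity identifies \<open>H (1 / (\<zeta> + n - \<omega>)) \<zeta>\<close>, which tends to
  \<open>H 0 \<zeta>\<close>, with \<open>G (1 / (\<zeta> + n - \<omega>)) \<omega>\<close>, which tends to \<open>G 0 \<omega>\<close>. So both are one constant.\<close>

lemma periodic_boundary_value:
  fixes H G :: "complex \<Rightarrow> complex \<Rightarrow> complex"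
  assumes H: "\<And>\<zeta>. (\<lambda>t. H t \<zeta>) holomorphic_on UNIV" and G: "\<And>\<omega>. (\<lambda>t. G t \<omega>) holomorphic_on UNIV"
    and HG: "\<And>t \<omega>. t \<noteq> 0 \<Longrightarrow> G t \<omega> = H t (\<omega> + 1 / t)"
    and per: "\<And>t \<zeta>. H t (\<zeta> + 1) = H t \<zeta>"
  shows "H 0 \<zeta> = G 0 \<omega>"
proof -
  have per_n: "H t (\<zeta> + of_nat n) = H t \<zeta>" for t n
  proof (induction n)
    case (Suc n)
    then show ?case
      using per[of t "\<zeta> + of_nat n"] by (simp add: add_ac)
  qed simp
  define t where "t = (\<lambda>n. inverse (of_nat n + (\<zeta> - \<omega>)) :: complex)"
  have t0: "t \<longlonglongrightarrow> 0"
    unfolding t_def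
    by (intro filterlim_compose[OF tendsto_inverse_0] tendsto_add_filterlim_at_infinity'[OF tendsto_of_nat tendsto_const])
  have lim: "(\<lambda>n. f (t n)) \<longlonglongrightarrow> f 0" if "f holomorphic_on UNIV" for f
    using holomorphic_on_imp_continuous_on[OF that] t0
    by (intro isCont_tendsto_compose[of 0 f]) (auto simp: continuous_on_eq_continuous_at)
  have "\<forall>\<^sub>F n in sequentially. of_nat n + (\<zeta> - \<omega>) \<noteq> 0"
    by (rule filterlim_at_infinity_imp_eventually_ne[OF
          tendsto_add_filterlim_at_infinity'[OF tendsto_of_nat tendsto_const]])
  then have "\<forall>\<^sub>F n in sequentially. H (t n) \<zeta> = G (t n) \<omega>"
  proof eventually_elim
    case (elim n)
    then have "t n \<noteq> 0" "\<omega> + 1 / t n = \<zeta> + of_nat n"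
      by (auto simp: t_def divide_inverse)
    then show ?case
      using HG[of "t n" \<omega>] per_n by simp
  qed
  then have "(\<lambda>n. G (t n) \<omega>) \<longlonglongrightarrow> H 0 \<zeta>"
    using lim[OF H] Lim_transform_eventually by fast
  then show ?thesis
    using lim[OF G] LIMSEQ_unique by blast
qed

text \<open>If the zero at 0 had finite order m, divisibility by t^(m+1) would force the
  non-vanishing cofactor of t^m to vanish at 0.\<close>

lemma entire_divisible_by_all_powers:
  assumes f: "f holomorphic_on UNIV"
    and div: "\<And>n. \<exists>k. k holomorphic_on UNIV \<and> (\<forall>t. f t = t ^ n * k t)"
  shows "f t = 0"
proof (rule ccontr)
  assume nz: "f t \<noteq> 0"
  have "f 0 = 0"
    using div[of 1] by auto
  then have "\<not> f constant_on UNIV"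
    using nz unfolding constant_on_def by (metis UNIV_I)
  then obtain g r m where g: "0 < r" "g holomorphic_on ball 0 r"
      "\<And>w. w \<in> ball 0 r \<Longrightarrow> f w = (w - 0) ^ m * g w" "\<And>w. w \<in> ball 0 r \<Longrightarrow> g w \<noteq> 0"
    using holomorphic_factor_zero_nonconstant[OF f open_UNIV connected_UNIV UNIV_I \<open>f 0 = 0\<close>] by metis
  obtain k where k: "k holomorphic_on UNIV" "\<And>t. f t = t ^ Suc m * k t"
    using div by blast
  have eq: "g w = w * k w" if "w \<in> ball 0 r - {0}" for w
    using g(3)[of w] k(2)[of w] that by simp
  have "isCont g 0" "isCont k 0"
    using g(1) holomorphic_on_imp_differentiable_at[OF g(2), of 0]
      holomorphic_on_imp_differentiable_at[OF k(1), of 0]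
    by (simp_all add: field_differentiable_imp_continuous_at)
  then have lim: "(g \<longlongrightarrow> g 0) (at 0)" "((\<lambda>w. w * k w) \<longlongrightarrow> 0 * k 0) (at 0)"
    unfolding isCont_def by (blast, intro tendsto_mult tendsto_ident_at, blast)
  have "\<forall>\<^sub>F w in at 0. w \<in> ball 0 r - {0}"
    using g(1) by (intro eventually_at_in_open) auto
  then have "\<forall>\<^sub>F w in at 0. w * k w = g w"
    by eventually_elim (simp add: eq)
  then have "(g \<longlongrightarrow> 0 * k 0) (at 0)"
    using lim(2) Lim_transform_eventually by fast
  then have "g 0 = 0"
    using lim(1) LIM_unique by fastforce
  then show False
    using g by auto
qed

text \<open>Subtracting the common boundary value and dividing by \<open>t\<close> preserves the hypotheses, hence
  \<open>H t \<zeta> - H t \<zeta>'\<close> vanishes to infinite order at \<open>t = 0\<close>.\<close>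

lemma periodic_imp_independent:
  fixes H G :: "complex \<Rightarrow> complex \<Rightarrow> complex"
  assumes H: "\<And>\<zeta>. (\<lambda>t. H t \<zeta>) holomorphic_on UNIV" and G: "\<And>\<omega>. (\<lambda>t. G t \<omega>) holomorphic_on UNIV"
    and HG: "\<And>t \<omega>. t \<noteq> 0 \<Longrightarrow> G t \<omega> = H t (\<omega> + 1 / t)"
    and per: "\<And>t \<zeta>. H t (\<zeta> + 1) = H t \<zeta>"
  shows "H t \<zeta> = H t \<zeta>'"
proof -
  have "\<exists>k. k holomorphic_on UNIV \<and> (\<forall>t. H t \<zeta> - H t \<zeta>' = t ^ n * k t)" for n
    using assms
  proof (induction n arbitrary: H G)
    case 0
    then have "(\<lambda>t. H t \<zeta> - H t \<zeta>') holomorphic_on UNIV"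
      by (intro holomorphic_intros)
    then show ?case
      by auto
  next
    case (Suc n)
    define q :: "(complex \<Rightarrow> complex) \<Rightarrow> complex \<Rightarrow> complex"
      where "q = (\<lambda>f t. if t = 0 then deriv f 0 else (f t - f 0) / (t - 0))"
    have q: "q f holomorphic_on UNIV" if "f holomorphic_on UNIV" for f
      unfolding q_def by (rule pole_lemma_open[OF that open_UNIV])
    have qt: "f t = f 0 + t * q f t" for f t
      by (simp add: q_def)
    have bd: "H 0 \<zeta> = G 0 \<omega>" for \<zeta> \<omega>
      by (rule periodic_boundary_value[OF Suc.prems])
    have "\<exists>k. k holomorphic_on UNIV \<and> (\<forall>t. q (\<lambda>s. H s \<zeta>) t - q (\<lambda>s. H s \<zeta>') t = t ^ n * k t)"
    proof (rule Suc.IH[of "\<lambda>t \<zeta>. q (\<lambda>s. H s \<zeta>) t" "\<lambda>t \<omega>. q (\<lambda>s. G s \<omega>) t"])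
      show "(\<lambda>t. q (\<lambda>s. H s \<zeta>) t) holomorphic_on UNIV" for \<zeta>
        by (rule q[OF Suc.prems(1)])
      show "(\<lambda>t. q (\<lambda>s. G s \<omega>) t) holomorphic_on UNIV" for \<omega>
        by (rule q[OF Suc.prems(2)])
      show "q (\<lambda>s. G s \<omega>) t = q (\<lambda>s. H s (\<omega> + 1 / t)) t" if "t \<noteq> 0" for t \<omega>
        using that Suc.prems(3)[OF that, of \<omega>] bd[of "\<omega> + 1 / t" \<omega>] by (simp add: q_def)
      show "q (\<lambda>s. H s (\<zeta> + 1)) t = q (\<lambda>s. H s \<zeta>) t" for t \<zeta>
        by (simp only: Suc.prems(4))
    qed
    then obtain k where k: "k holomorphic_on UNIV"
      "\<And>t. q (\<lambda>s. H s \<zeta>) t - q (\<lambda>s. H s \<zeta>') t = t ^ n * k t"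
      by blast
    have "H t \<zeta> - H t \<zeta>' = t ^ Suc n * k t" for t
    proof -
      have "H t \<zeta> - H t \<zeta>' = t * (q (\<lambda>s. H s \<zeta>) t - q (\<lambda>s. H s \<zeta>') t)"
        using qt[of "\<lambda>s. H s \<zeta>" t] qt[of "\<lambda>s. H s \<zeta>'" t] bd[of \<zeta> 0] bd[of \<zeta>' 0]
        by (simp only: right_diff_distrib) simp
      then show ?thesis
        by (simp add: k(2) mult.assoc)
    qed
    with k(1) show ?case
      by blast
  qed
  then show ?thesis
    using entire_divisible_by_all_powers[of "\<lambda>t. H t \<zeta> - H t \<zeta>'" t] H
    by (simp add: holomorphic_on_diff)
qed

section \<open>Functions on the disc invariant under a parabolic translation\<close>

lemma ratio_scale: "k \<noteq> 0 \<Longrightarrow> ratio (k * n) (k * d) = ratio n d"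
  by (simp add: ratio_def)

text \<open>Points of the disc give only the values t = 1 / (2 i Im \<zeta>), so periodicity and the
  differential equation are first known on this half-line. Its limit point 0 lets the identity
  theorem extend them.\<close>

lemma zero_islimpt_negative_imaginary_axis: "(0::complex) islimpt {t. Re t = 0 \<and> Im t < 0}"
  unfolding islimpt_approachable
proof (intro allI impI)
  fix \<epsilon> :: real assume "\<epsilon> > 0"
  then show "\<exists>x'\<in>{t. Re t = 0 \<and> Im t < 0}. x' \<noteq> 0 \<and> dist x' 0 < \<epsilon>"
    by (intro bexI[of _ "Complex 0 (- \<epsilon> / 2)"]) (auto simp: cmod_def complex_eq_iff)
qed

text \<open>In the half-plane coordinates \<open>\<zeta>\<close>, \<open>\<omega>\<close> the complexification is the set of pairs of points
  of the sphere with \<open>\<zeta> \<noteq> \<omega>\<close>; the coordinates \<open>(t, \<zeta>)\<close> with \<open>\<omega> = \<zeta> - 1 / t\<close> cover the part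
  with \<open>\<zeta>\<close> finite, and the disc itself is \<open>t = 1 / (\<zeta> - cnj \<zeta>)\<close>.\<close>

lemma periodic_in_A_D:
  assumes a: "Im a > 0" and e: "norm e = 1"
    and \<phi>: "\<And>z. z \<in> unit_disc \<Longrightarrow> \<phi> z = (a - cnj a * (e * z)) / (1 - e * z)"
    and f: "f \<in> A_D"
    and per: "\<And>z z'. z \<in> unit_disc \<Longrightarrow> z' \<in> unit_disc \<Longrightarrow> \<phi> z' = \<phi> z + 1 \<Longrightarrow> f z' = f z"
  obtains h where "h holomorphic_on UNIV" "\<And>z. z \<in> unit_disc \<Longrightarrow> f z = h (1 / (\<phi> z - cnj (\<phi> z)))"
proof -
  obtain F where F: "holo_Omega F" and fF: "\<And>z. z \<in> unit_disc \<Longrightarrow> f z = F (Some z, Some (cnj z))"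
    using f unfolding A_D_def represents_def by auto
  define b c where "b = cnj a" and "c = cnj e"
  have ec: "e * c = 1"
    using e complex_norm_square[of e] by (simp add: c_def)
  have ab: "a \<noteq> b"
    using a by (auto simp: b_def complex_eq_iff)
  \<comment> \<open>Both functions are F in half-plane coordinates, with \<omega> = \<zeta> - 1 / t
    in \<open>H\<close> and \<zeta> = \<omega> + 1 / t in \<open>G\<close>. Fractions are multiplied
    through by t, so that t = 0, where one point is at infinity, is included.\<close>
  define H where "H = (\<lambda>t \<zeta>. F (ratio (c * (\<zeta> - a)) (\<zeta> - b), ratio (e * (t * \<zeta> - 1 - b * t)) (t * \<zeta> - 1 - a * t)))"
  define G where "G = (\<lambda>t \<omega>. F (ratio (c * (t * \<omega> + 1 - a * t)) (t * \<omega> + 1 - b * t), ratio (e * (\<omega> - b)) (\<omega> - a)))"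
  have ne1: "c * (\<zeta> - a) * (e * (t * \<zeta> - 1 - b * t)) \<noteq> (\<zeta> - b) * (t * \<zeta> - 1 - a * t)" for t \<zeta>
  proof -
    have "c * (\<zeta> - a) * (e * (t * \<zeta> - 1 - b * t)) - (\<zeta> - b) * (t * \<zeta> - 1 - a * t)
      = (e * c) * (\<zeta> - a) * (t * \<zeta> - 1 - b * t) - (\<zeta> - b) * (t * \<zeta> - 1 - a * t)"
      by (simp add: mult_ac)
    also have "\<dots> = a - b"
      unfolding ec by (simp add: algebra_simps)
    finally show ?thesis
      using ab by auto
  qed
  have ne2: "c * (t * \<omega> + 1 - a * t) * (e * (\<omega> - b)) \<noteq> (t * \<omega> + 1 - b * t) * (\<omega> - a)" for t \<omega>
  proof -
    have "c * (t * \<omega> + 1 - a * t) * (e * (\<omega> - b)) - (t * \<omega> + 1 - b * t) * (\<omega> - a)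
      = (e * c) * (t * \<omega> + 1 - a * t) * (\<omega> - b) - (t * \<omega> + 1 - b * t) * (\<omega> - a)"
      by (simp add: mult_ac)
    also have "\<dots> = a - b"
      unfolding ec by (simp add: algebra_simps)
    finally show ?thesis
      using ab by auto
  qed
  have H1: "(\<lambda>t. H t \<zeta>) holomorphic_on UNIV" for \<zeta>
    unfolding H_def by (rule holo_Omega_along_curve[OF F open_UNIV _ _ _ _ ne1]) (intro holomorphic_intros)+
  have H2: "(\<lambda>\<zeta>. H t \<zeta>) holomorphic_on UNIV" for t
    unfolding H_def by (rule holo_Omega_along_curve[OF F open_UNIV _ _ _ _ ne1]) (intro holomorphic_intros)+
  have G1: "(\<lambda>t. G t \<omega>) holomorphic_on UNIV" for \<omega>
    unfolding G_def by (rule holo_Omega_along_curve[OF F open_UNIV _ _ _ _ ne2]) (intro holomorphic_intros)+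
  have HG: "G t \<omega> = H t (\<omega> + 1 / t)" if t: "t \<noteq> 0" for t \<omega>
  proof -
    have "c * (t * \<omega> + 1 - a * t) = t * (c * (\<omega> + 1 / t - a))" "t * \<omega> + 1 - b * t = t * (\<omega> + 1 / t - b)"
      "e * (t * (\<omega> + 1 / t) - 1 - b * t) = t * (e * (\<omega> - b))" "t * (\<omega> + 1 / t) - 1 - a * t = t * (\<omega> - a)"
      using t by (simp_all add: field_simps)
    then show ?thesis
      by (simp only: G_def H_def ratio_scale[OF t])
  qed
  have diag: "H (1 / (\<zeta> - cnj \<zeta>)) \<zeta> = f (c * (\<zeta> - a) / (\<zeta> - b))"
      "c * (\<zeta> - a) / (\<zeta> - b) \<in> unit_disc" "\<phi> (c * (\<zeta> - a) / (\<zeta> - b)) = \<zeta>"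
    if \<zeta>: "Im \<zeta> > 0" for \<zeta>
  proof -
    let ?z = "c * (\<zeta> - a) / (\<zeta> - b)"
    have nb: "\<zeta> \<noteq> b" "cnj \<zeta> \<noteq> a" "\<zeta> \<noteq> cnj \<zeta>"
      using \<zeta> a by (auto simp: b_def complex_eq_iff)
    have "norm ((\<zeta> - a) / (\<zeta> - b)) < 1"
      using cayley_less_one[OF a \<zeta>] by (simp add: b_def)
    moreover have "norm c = 1"
      using e by (simp add: c_def)
    ultimately show z: "?z \<in> unit_disc"
      by (simp add: norm_mult norm_divide)
    have ez: "e * ?z = (\<zeta> - a) / (\<zeta> - b)"
      using ec by (metis mult.assoc mult_1 times_divide_eq_right)
    have "1 - (\<zeta> - a) / (\<zeta> - b) = (a - b) / (\<zeta> - b)" "a - b * ((\<zeta> - a) / (\<zeta> - b)) = \<zeta> * ((a - b) / (\<zeta> - b))"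
      using nb by (simp_all add: field_simps)
    then show "\<phi> ?z = \<zeta>"
      using ab nb unfolding \<phi>[OF z] ez by (simp flip: b_def)
    let ?t = "1 / (\<zeta> - cnj \<zeta>)"
    have t0: "?t \<noteq> 0"
      using nb by simp
    have "?t * \<zeta> - 1 = ?t * cnj \<zeta>"
      using nb by (simp add: field_simps)
    then have t: "e * (?t * \<zeta> - 1 - b * ?t) = ?t * (e * (cnj \<zeta> - b))" "?t * \<zeta> - 1 - a * ?t = ?t * (cnj \<zeta> - a)"
      by (simp_all only: right_diff_distrib) (simp_all add: mult_ac)
    have "H ?t \<zeta> = F (ratio (c * (\<zeta> - a)) (\<zeta> - b), ratio (e * (cnj \<zeta> - b)) (cnj \<zeta> - a))"
      unfolding H_def t ratio_scale[OF t0] ..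
    also have "\<dots> = F (Some ?z, Some (cnj ?z))"
      using nb by (simp add: ratio_def b_def c_def)
    also have "\<dots> = f ?z"
      using fF[OF z] by simp
    finally show "H ?t \<zeta> = f ?z" .
  qed
  \<comment> \<open>The translation leaves \<zeta> - cnj \<zeta> unchanged, so it moves only the
    second argument of \<open>H\<close>.\<close>
  have per1: "H (1 / (\<zeta> - cnj \<zeta>)) (\<zeta> + 1) = H (1 / (\<zeta> - cnj \<zeta>)) \<zeta>" if \<zeta>: "Im \<zeta> > 0" for \<zeta>
  proof -
    have "H (1 / (\<zeta> - cnj \<zeta>)) (\<zeta> + 1) = f (c * (\<zeta> + 1 - a) / (\<zeta> + 1 - b))"
      using diag(1)[of "\<zeta> + 1"] \<zeta> by simp
    also have "\<dots> = f (c * (\<zeta> - a) / (\<zeta> - b))"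
      using diag(2,3)[OF \<zeta>] diag(2,3)[of "\<zeta> + 1"] \<zeta> by (intro per) simp_all
    finally show ?thesis
      using diag(1)[OF \<zeta>] by simp
  qed
  have per2: "H t (\<zeta> + 1) = H t \<zeta>" if t: "Re t = 0" "Im t < 0" for t \<zeta>
  proof -
    \<comment> \<open>The height at which 1 / (\<zeta> - cnj \<zeta>) equals t; the identity theorem
      spreads periodicity from this horizontal line to all \<zeta>.\<close>
    define y where "y = - 1 / (2 * Im t)"
    have "H t (\<zeta> + 1) - H t \<zeta> = 0"
    proof (rule analytic_continuation[where f = "\<lambda>\<zeta>. H t (\<zeta> + 1) - H t \<zeta>" and S = UNIV
          and U = "{\<zeta>. Im \<zeta> = y}" and \<xi> = "Complex 0 y"])
      have "(\<lambda>\<zeta>. H t (\<zeta> + 1)) holomorphic_on UNIV"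
        using holomorphic_on_compose_gen[OF _ H2[of t], of "\<lambda>\<zeta>. \<zeta> + 1" UNIV]
        by (simp add: o_def holomorphic_intros)
      then show "(\<lambda>\<zeta>. H t (\<zeta> + 1) - H t \<zeta>) holomorphic_on UNIV"
        by (intro holomorphic_on_diff H2)
      show "Complex 0 y islimpt {\<zeta>. Im \<zeta> = y}"
        unfolding islimpt_approachable
      proof (intro allI impI)
        fix \<epsilon> :: real assume "\<epsilon> > 0"
        then show "\<exists>x'\<in>{\<zeta>. Im \<zeta> = y}. x' \<noteq> Complex 0 y \<and> dist x' (Complex 0 y) < \<epsilon>"
          by (intro bexI[of _ "Complex (\<epsilon> / 2) y"]) (auto simp: dist_norm cmod_def)
      qed
      fix \<zeta> assume "\<zeta> \<in> {\<zeta>. Im \<zeta> = y}"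
      then have "Im \<zeta> = y" "1 / (\<zeta> - cnj \<zeta>) = t"
        using t by (auto simp: y_def complex_eq_iff Re_divide Im_divide power2_eq_square field_simps)
      moreover have "y > 0"
        using t by (simp add: y_def)
      ultimately show "H t (\<zeta> + 1) - H t \<zeta> = 0"
        using per1[of \<zeta>] by simp
    qed auto
    then show ?thesis
      by simp
  qed
  have per3: "H t (\<zeta> + 1) = H t \<zeta>" for t \<zeta>
  proof -
    have "H t (\<zeta> + 1) - H t \<zeta> = 0"
    proof (rule analytic_continuation[where f = "\<lambda>t. H t (\<zeta> + 1) - H t \<zeta>" and S = UNIV
          and U = "{t. Re t = 0 \<and> Im t < 0}" and \<xi> = 0])
      show "(\<lambda>t. H t (\<zeta> + 1) - H t \<zeta>) holomorphic_on UNIV"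
        by (intro holomorphic_on_diff H1)
    qed (use per2 zero_islimpt_negative_imaginary_axis in auto)
    then show ?thesis
      by simp
  qed
  show ?thesis
  \<comment> \<open>The base point 0 is arbitrary, since \<open>H t\<close> turns out to be
    constant.\<close>
  proof (rule that[of "\<lambda>t. H t 0"])
    fix z :: complex assume z: "z \<in> unit_disc"
    have ez: "norm (e * z) < 1"
      using z e by (simp add: norm_mult)
    have im: "Im (\<phi> z) > 0"
      using Im_cayley_inverse_pos[OF a ez] \<phi>[OF z] by simp
    have "1 - e * z \<noteq> 0"
      using ez by auto
    then have "\<phi> z - a = (a - b) * (e * z) / (1 - e * z)" "\<phi> z - b = (a - b) / (1 - e * z)"
      unfolding \<phi>[OF z] b_def[symmetric] by (simp_all add: field_simps)
    then have "c * (\<phi> z - a) / (\<phi> z - b) = c * (e * z)"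
      using ab \<open>1 - e * z \<noteq> 0\<close> by simp
    also have "\<dots> = z"
      using ec by (simp add: mult.assoc[symmetric] mult.commute[of c])
    finally show "f z = H (1 / (\<phi> z - cnj (\<phi> z))) 0"
      using diag(1)[OF im] periodic_imp_independent[OF H1 G1 HG per3] by metis
  qed (rule H1)
qed

lemma half_plane_qform:
  assumes e: "norm e = 1" and a: "Im a > 0" and z: "z \<in> unit_disc"
    and \<phi>: "\<phi> = (a - cnj a * (e * z)) / (1 - e * z)"
  shows "1 / (\<phi> - cnj \<phi>) = qform (1 / (a - cnj a)) (- e / (a - cnj a)) (- cnj e / (a - cnj a)) z"
    and "(\<phi> + cnj \<phi>) / (\<phi> - cnj \<phi>) = qform ((a + cnj a) / (a - cnj a)) (- 2 * cnj a * e / (a - cnj a)) (- 2 * a * cnj e / (a - cnj a)) z"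
proof -
  \<comment> \<open>Absorbing the rotation \<open>e\<close> and treating conjugates as separate
    variables leaves rational identities in a, b, \<alpha>, \<beta>.\<close>
  define b \<alpha> \<beta> where "b = cnj a" and "\<alpha> = e * z" and "\<beta> = cnj e * cnj z"
  have ab: "a - b \<noteq> 0"
    using a by (auto simp: b_def complex_eq_iff)
  have "norm \<alpha> < 1" "norm \<beta> < 1"
    using z e by (auto simp: \<alpha>_def \<beta>_def norm_mult)
  then have n1: "1 - \<alpha> \<noteq> 0" "1 - \<beta> \<noteq> 0"
    by auto
  have "e * cnj e = 1"
    using e complex_norm_square[of e] by simp
  then have zz: "z * cnj z = \<alpha> * \<beta>"
    by (simp add: \<alpha>_def \<beta>_def)
  have n2: "1 - \<alpha> * \<beta> \<noteq> 0"
    using one_minus_ne_0[OF z] zz by simp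
  have p: "\<phi> = (a - b * \<alpha>) / (1 - \<alpha>)" "cnj \<phi> = (b - a * \<beta>) / (1 - \<beta>)"
    unfolding \<phi> by (simp_all add: b_def \<alpha>_def \<beta>_def)
  have minus: "\<phi> - cnj \<phi> = (a - b) * (1 - \<alpha> * \<beta>) / ((1 - \<alpha>) * (1 - \<beta>))"
    unfolding p(2) unfolding p(1) using n1 by (simp add: divide_simps) (simp add: algebra_simps)
  have plus: "\<phi> + cnj \<phi> = ((a + b) * (1 + \<alpha> * \<beta>) - 2 * b * \<alpha> - 2 * a * \<beta>) / ((1 - \<alpha>) * (1 - \<beta>))"
    unfolding p(2) unfolding p(1) using n1 by (simp add: divide_simps) (simp add: algebra_simps)
  have "1 / (\<phi> - cnj \<phi>) = (1 - \<alpha>) * (1 - \<beta>) / ((a - b) * (1 - \<alpha> * \<beta>))"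
    by (simp add: minus)
  also have "\<dots> = qform (1 / (a - b)) (- e / (a - b)) (- cnj e / (a - b)) z"
    unfolding qform_def zz using ab n2 by (simp add: divide_simps) (simp add: \<alpha>_def \<beta>_def algebra_simps)
  finally show "1 / (\<phi> - cnj \<phi>) = qform (1 / (a - cnj a)) (- e / (a - cnj a)) (- cnj e / (a - cnj a)) z"
    by (simp add: b_def)
  have "(\<phi> + cnj \<phi>) / (\<phi> - cnj \<phi>) = ((a + b) * (1 + \<alpha> * \<beta>) - 2 * b * \<alpha> - 2 * a * \<beta>) / ((a - b) * (1 - \<alpha> * \<beta>))"
    unfolding minus plus using n1 by simp
  also have "\<dots> = qform ((a + b) / (a - b)) (- 2 * b * e / (a - b)) (- 2 * a * cnj e / (a - b)) z"
    unfolding qform_def zz using ab n2 by (simp add: divide_simps) (simp add: \<alpha>_def \<beta>_def algebra_simps)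
  finally show "(\<phi> + cnj \<phi>) / (\<phi> - cnj \<phi>) = qform ((a + cnj a) / (a - cnj a)) (- 2 * cnj a * e / (a - cnj a)) (- 2 * a * cnj e / (a - cnj a)) z"
    by (simp add: b_def)
qed

section \<open>The limit of small deformation parameter\<close>

text \<open>For t at most 1 each further factor t / (1 + m t) is at most 1 / (1 + m), so the factors
  build up the factorial while the initial t^2 survives. The constant 2 cancels
  \<open>fact 2\<close> in the base case.\<close>

lemma norm_cc_le:
  assumes t: "0 < t" "t \<le> 1"
  shows "norm (cc (of_real t) (n + 2)) \<le> 2 * t\<^sup>2 / fact (n + 2)"
proof (induction n)
  case 0
  have "norm (1 + of_real t :: complex) = 1 + t"
    using t norm_of_real[of "1 + t", where 'a = complex] by simp
  moreover have "t\<^sup>2 / (1 + t) \<le> t\<^sup>2"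
    using t by (simp add: divide_le_eq mult_le_cancel_left1)
  ultimately show ?case
    using t by (simp add: cc_def numeral_2_eq_2 norm_divide norm_mult)
next
  case (Suc n)
  have "norm (1 + of_nat (n + 2) * of_real t :: complex) = 1 + of_nat (n + 2) * t"
    using t norm_of_real[of "1 + of_nat (n + 2) * t", where 'a = complex] by (simp add: add_nonneg_nonneg)
  then have eq: "norm (cc (of_real t) (Suc n + 2)) = norm (cc (of_real t) (n + 2)) * (t / (1 + of_nat (n + 2) * t))"
    using t by (simp add: cc_def norm_divide norm_mult del: of_nat_add)
  have "t * (1 + of_nat (n + 2)) \<le> 1 + of_nat (n + 2) * t"
    using t by (simp add: algebra_simps)
  then have "t / (1 + of_nat (n + 2) * t) \<le> 1 / (1 + of_nat (n + 2))"
    using t by (simp add: field_simps add_pos_nonneg)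
  then have "norm (cc (of_real t) (Suc n + 2)) \<le> 2 * t\<^sup>2 / fact (n + 2) * (1 / (1 + of_nat (n + 2)))"
    unfolding eq using Suc t by (intro mult_mono) auto
  also have "\<dots> = 2 * t\<^sup>2 / fact (Suc n + 2)"
    by (simp add: fact_Suc field_simps)
  finally show ?case .
qed

lemma zero_of_norm_le_square:
  fixes x y :: complex
  assumes "\<And>t. 0 < t \<Longrightarrow> t \<le> 1 \<Longrightarrow> norm (x + of_real t * y) \<le> M * t\<^sup>2"
  shows "x = 0" "y = 0"
proof -
  define t where "t = (\<lambda>n. 1 / real (Suc n))"
  have t: "0 < t n" "t n \<le> 1" for n
    by (auto simp: t_def)
  have t0: "t \<longlonglongrightarrow> 0"
    unfolding t_def by (rule LIMSEQ_Suc[OF lim_1_over_n])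
  have t0': "(\<lambda>n. of_real (t n) :: complex) \<longlonglongrightarrow> 0"
    using tendsto_of_real[OF t0] by simp
  have "(\<lambda>n. norm (x + of_real (t n) * y)) \<longlonglongrightarrow> norm (x + 0 * y)"
    by (intro tendsto_intros t0')
  moreover have "(\<lambda>n. M * (t n)\<^sup>2) \<longlonglongrightarrow> M * 0\<^sup>2"
    by (intro tendsto_intros t0)
  ultimately have "norm (x + 0 * y) \<le> M * 0\<^sup>2"
    by (rule LIMSEQ_le) (use assms t in blast)
  then show x: "x = 0"
    by simp
  have "norm y \<le> M * t n" for n
    using assms[OF t, of n] t[of n] by (simp add: x norm_mult power2_eq_square)
  moreover have "(\<lambda>n. M * t n) \<longlonglongrightarrow> M * 0"
    by (intro tendsto_intros t0)
  ultimately have "norm y \<le> M * 0"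
    by (intro LIMSEQ_le_const[of "\<lambda>n. M * t n"]) auto
  then show "y = 0"
    by simp
qed

text \<open>Because \<open>cc\<close> decays like a reciprocal factorial, the tail of the star
  series is dominated by squares of Taylor terms of \<open>h\<close> about \<open>q\<close> with
  displacement \<open>q\<close>. An entire function has a Taylor series converging beyond that
  displacement.\<close>

lemma summable_taylor_squares:
  fixes h :: "complex \<Rightarrow> complex"
  assumes h: "h holomorphic_on UNIV"
  shows "summable (\<lambda>n. (norm ((deriv ^^ n) h q / fact n * q ^ n))\<^sup>2)"
proof -
  define x :: complex where "x = of_real (norm q + 1)"
  have "norm x = norm q + 1"
    unfolding x_def by (subst norm_of_real) simp
  then have x: "norm q < norm x"
    by simp
  have "(\<lambda>n. (deriv ^^ n) h q / fact n * (q + x - q) ^ n) sums h (q + x)"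
    by (rule holomorphic_power_series[of h q "norm x + 1"])
      (auto intro: holomorphic_on_subset[OF h] simp: dist_norm)
  then have "summable (\<lambda>n. (deriv ^^ n) h q / fact n * x ^ n)"
    by (simp add: sums_iff)
  then have sm: "summable (\<lambda>n. norm ((deriv ^^ n) h q / fact n * q ^ n))"
    using x by (rule powser_insidea)
  then have "(\<lambda>n. norm ((deriv ^^ n) h q / fact n * q ^ n)) \<longlonglongrightarrow> 0"
    by (rule summable_LIMSEQ_zero)
  then have "\<forall>\<^sub>F n in sequentially. norm ((deriv ^^ n) h q / fact n * q ^ n) < 1"
    by (rule order_tendstoD) simp
  then have "\<forall>\<^sub>F n in sequentially. norm ((norm ((deriv ^^ n) h q / fact n * q ^ n))\<^sup>2) \<le> norm ((deriv ^^ n) h q / fact n * q ^ n)"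
  proof eventually_elim
    case (elim n)
    then show ?case
      using mult_left_le[of "norm ((deriv ^^ n) h q / fact n * q ^ n)" "norm ((deriv ^^ n) h q / fact n * q ^ n)"]
      by (simp add: power2_eq_square)
  qed
  then show ?thesis
    using sm by (rule summable_comparison_test_ev)
qed

text \<open>The series is \<open>h q\<^sup>2 + t q\<^sup>2 h'(q)\<^sup>2 + O(t\<^sup>2)\<close> as \<open>t \<rightarrow> 0\<close>.\<close>

lemma star_series_affine_imp:
  assumes h: "h holomorphic_on UNIV"
    and eq: "\<And>t. 0 < t \<Longrightarrow> t \<le> 1 \<Longrightarrow> \<alpha> + of_real t * \<beta> =
      (\<Sum>n. cc (of_real t) n / fact n * (q\<^sup>2) ^ n * (deriv ^^ n) h q * (deriv ^^ n) h q)"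
  shows "\<alpha> = (h q)\<^sup>2" "\<beta> = q\<^sup>2 * (deriv h q)\<^sup>2"
proof -
  define e where "e = (\<lambda>n. (q\<^sup>2) ^ n * (deriv ^^ n) h q * (deriv ^^ n) h q / fact n)"
  have e_norm: "norm (e n) / fact n = (norm ((deriv ^^ n) h q / fact n * q ^ n))\<^sup>2" for n
    by (simp add: e_def norm_mult norm_divide norm_power power2_eq_square power_mult_distrib field_simps)
  have sm: "summable (\<lambda>n. norm (e n) / fact n)"
    unfolding e_norm by (rule summable_taylor_squares[OF h])
  define M where "M = 2 * (\<Sum>n. norm (e (n + 2)) / fact (n + 2))"
  have sm2: "summable (\<lambda>n. norm (e (n + 2)) / fact (n + 2))"
    by (rule summable_ignore_initial_segment[OF sm])
  \<comment> \<open>The terms of index 0 and 1 are exactly \<open>e 0\<close> and t times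
    \<open>e 1\<close>; only the tail from index 2 needs an estimate.\<close>
  have *: "norm ((\<alpha> - e 0) + of_real t * (\<beta> - e 1)) \<le> M * t\<^sup>2" if t: "0 < t" "t \<le> 1" for t
  proof -
    have le: "norm (cc (of_real t) (n + 2) * e (n + 2)) \<le> 2 * t\<^sup>2 * (norm (e (n + 2)) / fact (n + 2))" for n
      using mult_right_mono[OF norm_cc_le[OF t, of n] norm_ge_zero[of "e (n + 2)"]] by (simp add: norm_mult)
    have sm3: "summable (\<lambda>n. norm (cc (of_real t) (n + 2) * e (n + 2)))"
      by (rule summable_comparison_test'[OF summable_mult[OF sm2, of "2 * t\<^sup>2"], of 0]) (use le in auto)
    then have "summable (\<lambda>n. cc (of_real t) (n + 2) * e (n + 2))"
      by (rule summable_norm_cancel)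
    then have "summable (\<lambda>n. cc (of_real t) n * e n)"
      by (subst (asm) summable_iff_shift)
    then have "(\<Sum>n. cc (of_real t) n * e n) = (\<Sum>n. cc (of_real t) (n + 2) * e (n + 2)) + (\<Sum>n<2. cc (of_real t) n * e n)"
      by (rule suminf_split_initial_segment)
    moreover have "(\<Sum>n. cc (of_real t) n * e n) = \<alpha> + of_real t * \<beta>"
      unfolding eq[OF t] e_def by (simp add: mult_ac)
    ultimately have "(\<alpha> - e 0) + of_real t * (\<beta> - e 1) = (\<Sum>n. cc (of_real t) (n + 2) * e (n + 2))"
      by (simp add: numeral_2_eq_2 cc_def algebra_simps)
    also have "norm \<dots> \<le> (\<Sum>n. norm (cc (of_real t) (n + 2) * e (n + 2)))"
      by (rule summable_norm[OF sm3])
    also have "\<dots> \<le> (\<Sum>n. 2 * t\<^sup>2 * (norm (e (n + 2)) / fact (n + 2)))"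
      by (rule suminf_le[OF le sm3 summable_mult[OF sm2]])
    also have "\<dots> = M * t\<^sup>2"
      unfolding M_def by (subst suminf_mult[OF sm2]) simp
    finally show ?thesis .
  qed
  have "\<alpha> - e 0 = 0" "\<beta> - e 1 = 0"
    by (rule zero_of_norm_le_square[OF *], assumption+)+
  then show "\<alpha> = (h q)\<^sup>2" "\<beta> = q\<^sup>2 * (deriv h q)\<^sup>2"
    by (simp_all add: e_def power2_eq_square)
qed

text \<open>If \<open>h - h 0\<close> vanishes at \<open>0\<close> to the finite order \<open>m\<close>, the two sides of the differential
  equation vanish there to the orders \<open>m\<close> (as \<open>h 0 \<noteq> 0\<close>) and \<open>2 m\<close>.\<close>

lemma entire_solution_constant:
  assumes h: "h holomorphic_on UNIV"
    and eq: "\<And>q. Re q = 0 \<Longrightarrow> Im q < 0 \<Longrightarrow> (h q)\<^sup>2 - 1 = q\<^sup>2 * (deriv h q)\<^sup>2"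
  shows "h q = h 0" "(h 0)\<^sup>2 = 1"
proof -
  have ode: "(h q)\<^sup>2 - 1 = q\<^sup>2 * (deriv h q)\<^sup>2" for q
  proof -
    have "(h q)\<^sup>2 - 1 - q\<^sup>2 * (deriv h q)\<^sup>2 = 0"
      by (rule analytic_continuation[where f = "\<lambda>q. (h q)\<^sup>2 - 1 - q\<^sup>2 * (deriv h q)\<^sup>2" and S = UNIV,
            OF _ open_UNIV connected_UNIV subset_UNIV UNIV_I zero_islimpt_negative_imaginary_axis])
        (use eq h in \<open>auto intro!: holomorphic_intros\<close>)
    then show ?thesis
      by simp
  qed
  show c: "(h 0)\<^sup>2 = 1"
    using ode[of 0] by simp
  show "h q = h 0"
  proof (rule ccontr)
    assume nz: "h q \<noteq> h 0"
    have g: "(\<lambda>w. h w - h 0) holomorphic_on UNIV"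
      using h by (intro holomorphic_intros)
    have "\<not> (\<lambda>w. h w - h 0) constant_on UNIV"
      using nz unfolding constant_on_def by (metis UNIV_I right_minus_eq)
    note nc = this
    obtain k r m where k: "0 < m" "0 < r" "k holomorphic_on ball 0 r"
      "\<And>w. w \<in> ball 0 r \<Longrightarrow> h w - h 0 = (w - 0) ^ m * k w" "\<And>w. w \<in> ball 0 r \<Longrightarrow> k w \<noteq> 0"
      using holomorphic_factor_zero_nonconstant[OF g open_UNIV connected_UNIV UNIV_I right_minus_eq[THEN iffD2, OF refl] nc]
      by metis
    \<comment> \<open>The difference of the two sides of the equation divided by w^m. At 0 only the
      term -2 k(0) h(0) remains, as m is positive.\<close>
    define P where "P = (\<lambda>w. w ^ m * (of_nat m * k w + w * deriv k w)\<^sup>2 - k w * (w ^ m * k w + 2 * h 0))"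
    have P: "P w = 0" if w: "w \<in> ball 0 r - {0}" for w
    proof -
      have "((\<lambda>w. w ^ m * k w + h 0) has_field_derivative (of_nat m * w ^ (m - 1) * k w + w ^ m * deriv k w)) (at w)"
        using holomorphic_derivI[OF k(3) open_ball, of w] w by (auto intro!: derivative_eq_intros)
      moreover have "w ^ m * k w + h 0 = h w" if "w \<in> ball 0 r" for w
        using k(4)[OF that] by (simp add: algebra_simps)
      ultimately have "(h has_field_derivative (of_nat m * w ^ (m - 1) * k w + w ^ m * deriv k w)) (at w)"
        using w by (intro has_field_derivative_transform_within_open[of "\<lambda>w. w ^ m * k w + h 0" _ w "ball 0 r" h]) auto
      then have "w * deriv h w = w * (of_nat m * w ^ (m - 1) * k w + w ^ m * deriv k w)"
        by (simp add: DERIV_imp_deriv)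
      also have "\<dots> = w ^ m * (of_nat m * k w + w * deriv k w)"
        using k(1) by (cases m) (simp_all add: algebra_simps)
      finally have d: "w * deriv h w = w ^ m * (of_nat m * k w + w * deriv k w)" .
      have hw: "h w = h 0 + w ^ m * k w"
        using k(4)[of w] w by (simp add: algebra_simps)
      have "(h w)\<^sup>2 - 1 = (w * deriv h w)\<^sup>2"
        by (simp add: ode power_mult_distrib)
      moreover have "(h w)\<^sup>2 - 1 = w ^ m * (k w * (w ^ m * k w + 2 * h 0))"
        unfolding hw using c by (simp add: power2_eq_square algebra_simps)
      ultimately have "w ^ m * P w = 0"
        unfolding d P_def by (simp add: power2_eq_square algebra_simps)
      then show ?thesis
        using w by simp
    qed
    have "P holomorphic_on ball 0 r"
      unfolding P_def using k(3) by (intro holomorphic_intros) auto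
    then have "isCont P 0"
      using k(2) by (intro field_differentiable_imp_continuous_at holomorphic_on_imp_differentiable_at) auto
    then have "(P \<longlongrightarrow> P 0) (at 0)"
      by (simp add: isCont_def)
    moreover have "\<forall>\<^sub>F w in at 0. w \<in> ball 0 r - {0}"
      using k(2) by (intro eventually_at_in_open) auto
    then have "\<forall>\<^sub>F w in at 0. P w = 0"
      by eventually_elim (rule P)
    ultimately have "((\<lambda>w::complex. 0) \<longlongrightarrow> P 0) (at 0)"
      by (rule Lim_transform_eventually)
    then have "P 0 = 0"
      by (simp add: tendsto_const_iff)
    then have "k 0 * h 0 = 0"
      using k(1) by (simp add: P_def power_0_left)
    then show False
      using k(2) k(5)[of 0] c by auto
  qed
qed

section \<open>The annulus and the punctured disc\<close>

lemma exp_vimage_annulus: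
  assumes "R > 1"
  shows "exp -` annulus R = {z. - ln R < Re z \<and> Re z < ln R}"
proof -
  have "1 / R < exp x \<longleftrightarrow> - ln R < x" "exp x < R \<longleftrightarrow> x < ln R" for x
    using assms exp_less_cancel_iff[of "- ln R" x] exp_less_cancel_iff[of x "ln R"]
    by (simp_all add: exp_minus inverse_eq_divide)
  then show ?thesis
    by (auto simp: annulus_def)
qed

lemma exp_vimage_punct_disc: "exp -` punct_disc = {z. Re z < 0}"
  by (auto simp: punct_disc_def)

text \<open>The linear factor turns the strip into the horizontal strip of half-width pi/2, whose
  exponential is the right half-plane; the outer factor \<open>\<i>\<close> rotates it.\<close>

lemma bij_betw_strip_half_plane:
  assumes r: "r > 0"
  shows "bij_betw (\<lambda>w. \<i> * exp (\<i> * of_real (pi / (2 * r)) * w)) {z. - r < Re z \<and> Re z < r} {\<zeta>. Im \<zeta> > 0}"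
proof -
  let ?c = "\<i> * of_real (pi / (2 * r))"
  have c: "?c \<noteq> 0"
    using r by simp
  have Re_c: "Im (?c * w) = pi / (2 * r) * Re w" for w
    by simp
  have lt: "\<bar>pi / (2 * r) * x\<bar> < pi / 2" if "- r < x" "x < r" for x
  proof -
    have "pi / (2 * r) * \<bar>x\<bar> < pi / (2 * r) * r"
      by (rule mult_strict_left_mono) (use that r in auto)
    then show ?thesis
      using r by (simp add: abs_mult)
  qed
  show ?thesis
  proof (rule bij_betw_byWitness[where f' = "\<lambda>\<zeta>. Ln (\<zeta> / \<i>) / ?c"], goal_cases)
    case 1
    show ?case
    proof
      fix w assume "w \<in> {z. - r < Re z \<and> Re z < r}"
      then have "\<bar>Im (?c * w)\<bar> < pi / 2"
        unfolding Re_c using lt by blast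
      then have "Ln (exp (?c * w)) = ?c * w"
        by (intro Ln_exp) (use pi_gt_zero in linarith)+
      then show "Ln (\<i> * exp (?c * w) / \<i>) / ?c = w"
        using c by simp
    qed
  next
    case 2
    show ?case
    proof
      fix \<zeta> :: complex assume "\<zeta> \<in> {\<zeta>. Im \<zeta> > 0}"
      then have "\<zeta> / \<i> \<noteq> 0"
        by auto
      then show "\<i> * exp (?c * (Ln (\<zeta> / \<i>) / ?c)) = \<zeta>"
        using c by (simp add: exp_Ln)
    qed
  next
    case 3
    show ?case
    proof (rule image_subsetI)
      fix w assume "w \<in> {z. - r < Re z \<and> Re z < r}"
      then have "\<bar>pi / (2 * r) * Re w\<bar> < pi / 2"
        using lt by blast
      then have "0 < cos (pi / (2 * r) * Re w)"
        by (intro cos_gt_zero_pi; linarith)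
      moreover have "Im (\<i> * exp (?c * w)) = exp (Re (?c * w)) * cos (Im (?c * w))"
        by (simp add: Re_exp)
      ultimately show "\<i> * exp (?c * w) \<in> {\<zeta>. Im \<zeta> > 0}"
        unfolding Re_c by simp
    qed
  next
    case 4
    show ?case
    proof clarify
      fix \<zeta> :: complex assume \<zeta>: "Im \<zeta> > 0"
      have "Re (\<zeta> / \<i>) > 0" "\<zeta> / \<i> \<noteq> 0"
        using \<zeta> by (auto simp: Re_divide)
      then have "\<bar>Im (Ln (\<zeta> / \<i>))\<bar> < pi / 2"
        using Re_Ln_pos_lt by blast
      then have "2 * r / pi * \<bar>Im (Ln (\<zeta> / \<i>))\<bar> < 2 * r / pi * (pi / 2)"
        by (rule mult_strict_left_mono) (use r in auto)
      then have "\<bar>2 * r / pi * Im (Ln (\<zeta> / \<i>))\<bar> < r"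
        using r by (simp add: abs_mult)
      moreover have "Re (Ln (\<zeta> / \<i>) / ?c) = 2 * r / pi * Im (Ln (\<zeta> / \<i>))"
        using r by (simp add: Re_divide power2_eq_square field_simps)
      ultimately have "\<bar>Re (Ln (\<zeta> / \<i>) / ?c)\<bar> < r"
        by (simp only:)
      then show "- r < Re (Ln (\<zeta> / \<i>) / ?c) \<and> Re (Ln (\<zeta> / \<i>) / ?c) < r"
        by (metis abs_less_iff minus_less_iff)
    qed
  qed
qed

lemma annulus_function:
  assumes R: "R > 1"
  obtains s A B C where "A\<^sup>2 - B * C = 1" "\<And>z. z \<in> unit_disc \<Longrightarrow> s (ucov (annulus R) z) = qform A B C z"
    "\<And>x. x \<notin> annulus R \<Longrightarrow> s x = 0" "\<exists>z\<in>unit_disc. qform A B C z = 0"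
    "ucov (annulus R) ` unit_disc = annulus R"
proof -
  define r where "r = ln R"
  have r: "r > 0"
    using R by (simp add: r_def)
  have U: "exp -` annulus R = {z. - r < Re z \<and> Re z < r}"
    using exp_vimage_annulus[OF R] by (simp add: r_def)
  have "open (annulus R)"
    unfolding annulus_def by (intro open_Collect_conj open_Collect_less continuous_intros)
  moreover have "0 \<notin> annulus R"
    using R by (simp add: annulus_def)
  moreover have "convex (exp -` annulus R)"
    unfolding U Collect_conj_eq by (intro convex_Int convex_halfspace_Re_gt convex_halfspace_Re_lt)
  moreover have "0 \<in> exp -` annulus R" "of_real r \<notin> exp -` annulus R"
    unfolding U using r by auto
  then have "exp -` annulus R \<noteq> {}" "exp -` annulus R \<noteq> UNIV"
    by blast+
  ultimately obtain L where L: "L holomorphic_on unit_disc" "bij_betw L unit_disc (exp -` annulus R)"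
    "\<And>z. z \<in> unit_disc \<Longrightarrow> ucov (annulus R) z = exp (L z)" "ucov (annulus R) ` unit_disc = annulus R"
    using ucov_eq_exp by metis
  define c where "c = \<i> * of_real (pi / (2 * r))"
  define \<phi> where "\<phi> = (\<lambda>z. \<i> * exp (c * L z))"
  have hol: "\<phi> holomorphic_on unit_disc"
    unfolding \<phi>_def using L(1) by (intro holomorphic_intros)
  have bij: "bij_betw \<phi> unit_disc {\<zeta>. Im \<zeta> > 0}"
    using bij_betw_trans[OF L(2)[unfolded U] bij_betw_strip_half_plane[OF r]] by (simp add: \<phi>_def c_def o_def)
  obtain a e where a: "Im a > 0" and e: "norm e = 1"
    and \<phi>: "\<And>z. z \<in> unit_disc \<Longrightarrow> \<phi> z = (a - cnj a * (e * z)) / (1 - e * z)"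
    using upper_half_plane_uniformization[OF hol bij] by blast
  define A B C where "A = (a + cnj a) / (a - cnj a)" and "B = - 2 * cnj a * e / (a - cnj a)"
    and "C = - 2 * a * cnj e / (a - cnj a)"
  have Q: "qform A B C z = (\<phi> z + cnj (\<phi> z)) / (\<phi> z - cnj (\<phi> z))" if "z \<in> unit_disc" for z
    using half_plane_qform(2)[OF e a that \<phi>[OF that]] by (simp add: A_def B_def C_def)
  have inv: "qform A B C z = qform A B C z'"
    if z: "z \<in> unit_disc" "z' \<in> unit_disc" "ucov (annulus R) z = ucov (annulus R) z'" for z z'
  proof -
    \<comment> \<open>Points over the same point of the annulus differ by a period of
      \<open>exp\<close>, which multiplies \<phi> by a positive real; the quotient defining the form
      is homogeneous of degree 0.\<close>
    obtain n :: int where "L z = L z' + of_int (2 * n) * of_real pi * \<i>"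
      using z L(3) exp_eq[of "L z" "L z'"] by auto
    then have "c * L z = c * L z' + of_real (- pi * pi * of_int n / r)"
      using r by (simp add: c_def field_simps)
    then have k: "\<phi> z = of_real (exp (- pi * pi * of_int n / r)) * \<phi> z'"
      by (simp only: \<phi>_def exp_add exp_of_real) (simp only: mult_ac)
    define k where "k = exp (- pi * pi * of_int n / r)"
    have "k \<noteq> 0"
      by (simp add: k_def)
    moreover have "\<phi> z + cnj (\<phi> z) = of_real k * (\<phi> z' + cnj (\<phi> z'))" "\<phi> z - cnj (\<phi> z) = of_real k * (\<phi> z' - cnj (\<phi> z'))"
      unfolding k k_def[symmetric] by (simp_all add: algebra_simps)
    ultimately show ?thesis
      unfolding Q[OF z(1)] Q[OF z(2)] by simp
  qed
  define s where "s = (\<lambda>x. if x \<in> annulus R then qform A B C (SOME z. z \<in> unit_disc \<and> ucov (annulus R) z = x) else 0)"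
  show ?thesis
  proof (rule that[of A B C s])
    have "e * cnj e = 1"
      using e complex_norm_square[of e] by simp
    then have "B * C = 4 * a * cnj a / (a - cnj a)\<^sup>2"
      by (simp add: B_def C_def power2_eq_square)
    moreover have "a - cnj a \<noteq> 0"
      using a by (auto simp: complex_eq_iff)
    \<comment> \<open>This is (a + cnj a)^2 - 4 a cnj a = (a - cnj a)^2.\<close>
    ultimately show "A\<^sup>2 - B * C = 1"
      by (simp add: A_def power_divide flip: diff_divide_distrib) (simp add: power2_eq_square algebra_simps)
    fix z :: complex assume z: "z \<in> unit_disc"
    let ?z' = "SOME z'. z' \<in> unit_disc \<and> ucov (annulus R) z' = ucov (annulus R) z"
    have "?z' \<in> unit_disc \<and> ucov (annulus R) ?z' = ucov (annulus R) z"
      by (rule someI[of _ z]) (use z in simp)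
    then have "qform A B C ?z' = qform A B C z"
      using inv z by blast
    then show "s (ucov (annulus R) z) = qform A B C z"
      using L(4) z by (auto simp: s_def)
  next
    \<comment> \<open>At \<phi> = i the sum of \<phi> and its conjugate vanishes; this zero later
      shows that s is not a constant of square 1.\<close>
    have "\<i> \<in> \<phi> ` unit_disc"
      using bij by (simp add: bij_betw_def)
    then obtain z where "z \<in> unit_disc" "\<phi> z = \<i>"
      by auto
    then show "\<exists>z\<in>unit_disc. qform A B C z = 0"
      by (intro bexI[of _ z]) (simp_all add: Q)
  qed (use L(4) in \<open>auto simp: s_def\<close>)
qed

lemma punct_disc_functions:
  obtains A B C where "A\<^sup>2 - B * C = 0"
    "\<And>f. f \<in> A_X punct_disc \<Longrightarrow> \<exists>h. h holomorphic_on UNIV \<and> (\<forall>z\<in>unit_disc. f (ucov punct_disc z) = h (qform A B C z))"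
    "\<And>z z'. z \<in> unit_disc \<Longrightarrow> z' \<in> unit_disc \<Longrightarrow> ucov punct_disc z = ucov punct_disc z' \<Longrightarrow> qform A B C z = qform A B C z'"
    "\<And>q. Re q = 0 \<Longrightarrow> Im q < 0 \<Longrightarrow> \<exists>z\<in>unit_disc. qform A B C z = q"
    "ucov punct_disc ` unit_disc = punct_disc"
proof -
  have "open punct_disc" "0 \<notin> punct_disc"
    by (auto simp: punct_disc_def)
  moreover have "convex {z. Re z < 0}"
    by (rule convex_halfspace_Re_lt)
  moreover have "-1 \<in> {z. Re z < 0}" "1 \<notin> {z. Re z < 0}"
    by auto
  then have "{z. Re z < 0} \<noteq> {}" "{z. Re z < 0} \<noteq> UNIV"
    by blast+
  ultimately obtain L where L: "L holomorphic_on unit_disc" "bij_betw L unit_disc {z. Re z < 0}"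
    "\<And>z. z \<in> unit_disc \<Longrightarrow> ucov punct_disc z = exp (L z)" "ucov punct_disc ` unit_disc = punct_disc"
    using ucov_eq_exp[of punct_disc] unfolding exp_vimage_punct_disc by metis
  \<comment> \<open>The period 2 pi i of the exponential becomes the translation by 1.\<close>
  define \<phi> where "\<phi> = (\<lambda>z. L z / (2 * of_real pi * \<i>))"
  have L\<phi>: "L z = 2 * of_real pi * \<i> * \<phi> z" for z
    by (simp add: \<phi>_def)
  have hol: "\<phi> holomorphic_on unit_disc"
    unfolding \<phi>_def using L(1) by (intro holomorphic_intros) auto
  have "bij_betw (\<lambda>w. w / (2 * of_real pi * \<i>)) {z. Re z < 0} {\<zeta>. Im \<zeta> > 0}"
    by (rule bij_betw_byWitness[where f' = "\<lambda>\<zeta>. 2 * of_real pi * \<i> * \<zeta>"])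
      (auto simp: Im_divide divide_neg_pos mult_pos_neg power2_eq_square zero_less_divide_iff)
  then have bij: "bij_betw \<phi> unit_disc {\<zeta>. Im \<zeta> > 0}"
    using bij_betw_trans[OF L(2)] by (simp add: \<phi>_def o_def)
  obtain a e where a: "Im a > 0" and e: "norm e = 1"
    and \<phi>: "\<And>z. z \<in> unit_disc \<Longrightarrow> \<phi> z = (a - cnj a * (e * z)) / (1 - e * z)"
    using upper_half_plane_uniformization[OF hol bij] by blast
  define A B C where "A = 1 / (a - cnj a)" and "B = - e / (a - cnj a)" and "C = - cnj e / (a - cnj a)"
  have Q: "qform A B C z = 1 / (\<phi> z - cnj (\<phi> z))" if "z \<in> unit_disc" for z
    using half_plane_qform(1)[OF e a that \<phi>[OF that]] by (simp add: A_def B_def C_def)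
  show ?thesis
  proof (rule that[of A B C])
    have "e * cnj e = 1"
      using e complex_norm_square[of e] by simp
    then show "A\<^sup>2 - B * C = 0"
      by (simp add: A_def B_def C_def power2_eq_square)
  next
    fix f assume f: "f \<in> A_X punct_disc"
    then have f': "pull punct_disc f \<in> A_D"
      by (simp add: A_X_def)
    have "pull punct_disc f z' = pull punct_disc f z"
      if "z \<in> unit_disc" "z' \<in> unit_disc" "\<phi> z' = \<phi> z + 1" for z z'
    proof -
      have "exp (L z') = exp (L z)"
        unfolding L\<phi> that(3) by (simp add: distrib_left exp_add)
      then show ?thesis
        using that L(3) by (simp add: pull_def)
    qed
    then obtain h where "h holomorphic_on UNIV"
      "\<And>z. z \<in> unit_disc \<Longrightarrow> pull punct_disc f z = h (1 / (\<phi> z - cnj (\<phi> z)))"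
      using periodic_in_A_D[OF a e \<phi> f'] by blast
    then show "\<exists>h. h holomorphic_on UNIV \<and> (\<forall>z\<in>unit_disc. f (ucov punct_disc z) = h (qform A B C z))"
      using Q by (auto simp: pull_def)
  next
    fix z z' :: complex assume z: "z \<in> unit_disc" "z' \<in> unit_disc" "ucov punct_disc z = ucov punct_disc z'"
    then have "exp (Re (L z)) = exp (Re (L z'))"
      using L(3) by (metis norm_exp_eq_Re)
    \<comment> \<open>The form depends only on Im \<phi>, that is, on the modulus of the point of
      the punctured disc.\<close>
    then have "Im (\<phi> z) = Im (\<phi> z')"
      unfolding L\<phi> by simp
    then have "\<phi> z - cnj (\<phi> z) = \<phi> z' - cnj (\<phi> z')"
      by (simp add: complex_eq_iff)
    then show "qform A B C z = qform A B C z'"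
      using Q z by simp
  next
    fix q assume q: "Re q = 0" "Im q < 0"
    have "Complex 0 (- 1 / (2 * Im q)) \<in> \<phi> ` unit_disc"
      using bij q by (simp add: bij_betw_def divide_neg_neg)
    then obtain z where z: "z \<in> unit_disc" "\<phi> z = Complex 0 (- 1 / (2 * Im q))"
      by auto
    have "qform A B C z = q"
      unfolding Q[OF z(1)] z(2) using q
      by (simp add: complex_eq_iff Re_divide Im_divide power2_eq_square field_simps)
    with z show "\<exists>z\<in>unit_disc. qform A B C z = q"
      by blast
  qed (use L(4) in auto)
qed

section \<open>The unit and the comparison of star squares\<close>

text \<open>One preimage serves all parameters and all factors, so coefficients in the parameter can
  be compared at a fixed point of the disc.\<close>

lemma star_X_eq:
  assumes "ucov X ` unit_disc = X" "x \<in> X"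
  obtains z where "z \<in> unit_disc" "ucov X z = x" "\<And>t f g. star_X X t f g x = star_D t (pull X f) (pull X g) z"
proof
  let ?z = "SOME z. z \<in> unit_disc \<and> ucov X z = x"
  have "\<exists>z. z \<in> unit_disc \<and> ucov X z = x"
    using assms by (metis imageE)
  then have "?z \<in> unit_disc \<and> ucov X ?z = x"
    by (rule someI_ex)
  then show "?z \<in> unit_disc" "ucov X ?z = x"
    by auto
  show "star_X X t f g x = star_D t (pull X f) (pull X g) ?z" for t f g
    using assms(2) by (simp add: star_X_def)
qed

definition unit_fun :: "complex set \<Rightarrow> complex \<Rightarrow> complex" where
  "unit_fun X = (\<lambda>x. if x \<in> X then 1 else 0)"

lemma A_X_qform:
  assumes im: "ucov X ` unit_disc = X" and k: "k holomorphic_on UNIV"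
    and f: "\<And>z. z \<in> unit_disc \<Longrightarrow> f (ucov X z) = k (qform A B C z)" and f0: "\<And>x. x \<notin> X \<Longrightarrow> f x = 0"
  shows "f \<in> A_X X"
proof -
  have "pull X f \<in> A_D"
    by (rule A_D_qform[OF k]) (use f in \<open>auto simp: pull_def\<close>)
  then show ?thesis
    using f0 by (simp add: A_X_def)
qed

lemma unit_fun_in_A_X: "ucov X ` unit_disc = X \<Longrightarrow> unit_fun X \<in> A_X X"
  by (rule A_X_qform[where k = "\<lambda>x. 1" and A = 0 and B = 0 and C = 0]) (auto simp: unit_fun_def)

lemma star_X_unit:
  assumes im: "ucov X ` unit_disc = X" and f: "f \<in> A_X X"
  shows "star_X X t f (unit_fun X) = f" "star_X X t (unit_fun X) f = f"
proof -
  have one: "pull X (unit_fun X) z = 1" if "z \<in> unit_disc" for z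
    using that im by (auto simp: pull_def unit_fun_def)
  have "star_X X t f (unit_fun X) x = f x \<and> star_X X t (unit_fun X) f x = f x" for x
  proof (cases "x \<in> X")
    case True
    then obtain z where z: "z \<in> unit_disc" "ucov X z = x"
      "\<And>t f g. star_X X t f g x = star_D t (pull X f) (pull X g) z"
      using star_X_eq[OF im] by metis
    have "star_D t (pull X f) (pull X (unit_fun X)) z = pull X f z"
      "star_D t (pull X (unit_fun X)) (pull X f) z = pull X f z"
      using star_D_one_right star_D_one_left one z(1) by blast+
    moreover have "pull X f z = f x"
      using z(1,2) by (simp add: pull_def)
    ultimately show ?thesis
      unfolding z(3) by simp
  next
    case False
    then show ?thesis
      using f by (simp add: star_X_def A_X_def)
  qed
  then show "star_X X t f (unit_fun X) = f" "star_X X t (unit_fun X) f = f"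
    by auto
qed

theorem mainTheorem7:
  fixes R :: real
  assumes "R > 1"
  shows "\<not> (\<exists>\<Psi>. strong_iso (annulus R) punct_disc \<Psi>)"
proof
  assume "\<exists>\<Psi>. strong_iso (annulus R) punct_disc \<Psi>"
  then obtain \<Psi> where \<Psi>: "strong_iso (annulus R) punct_disc \<Psi>" by blast
  define X where "X = annulus R"
  define Y where "Y = punct_disc"
  have bij: "bij_betw \<Psi> (A_X X) (A_X Y)"
    and add: "\<And>f g. f \<in> A_X X \<Longrightarrow> g \<in> A_X X \<Longrightarrow> \<Psi> (\<lambda>x. f x + g x) = (\<lambda>y. \<Psi> f y + \<Psi> g y)"
    and scale: "\<And>c f. f \<in> A_X X \<Longrightarrow> \<Psi> (\<lambda>x. c * f x) = (\<lambda>y. c * \<Psi> f y)"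
    and mult: "\<And>t f g. t \<in> hdom \<Longrightarrow> f \<in> A_X X \<Longrightarrow> g \<in> A_X X \<Longrightarrow> \<Psi> (star_X X t f g) = star_X Y t (\<Psi> f) (\<Psi> g)"
    using \<Psi> unfolding strong_iso_def X_def Y_def by blast+
  have im_\<Psi>: "\<Psi> f \<in> A_X Y" if "f \<in> A_X X" for f
    using bij that by (auto simp: bij_betw_def)
  \<comment> \<open>Positive reals avoid all excluded parameters and accumulate at 0.\<close>
  have hdom: "of_real t \<in> hdom" if "t > 0" for t :: real
  proof -
    have "(of_real t :: complex) \<noteq> - 1 / of_nat k" for k :: nat
    proof
      assume "(of_real t :: complex) = - 1 / of_nat k"
      then have "Re (of_real t :: complex) = Re (- 1 / of_nat k)"
        by simp
      then have "t = - 1 / real k"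
        by (simp add: Re_divide_of_nat)
      moreover have "- 1 / real k \<le> 0"
        by simp
      ultimately show False
        using that by linarith
    qed
    then show ?thesis
      using that by (auto simp: hdom_def)
  qed
  obtain s A B C where cas: "A\<^sup>2 - B * C = 1"
    and s: "\<And>z. z \<in> unit_disc \<Longrightarrow> s (ucov X z) = qform A B C z" and s0: "\<And>x. x \<notin> X \<Longrightarrow> s x = 0"
    and zero: "\<exists>z\<in>unit_disc. qform A B C z = 0" and imX: "ucov X ` unit_disc = X"
    using annulus_function[OF assms] unfolding X_def by metis
  obtain A' B' C' where cas': "A'\<^sup>2 - B' * C' = 0"
    and rep: "\<And>f. f \<in> A_X Y \<Longrightarrow> \<exists>h. h holomorphic_on UNIV \<and> (\<forall>z\<in>unit_disc. f (ucov Y z) = h (qform A' B' C' z))"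
    and inv: "\<And>z z'. z \<in> unit_disc \<Longrightarrow> z' \<in> unit_disc \<Longrightarrow> ucov Y z = ucov Y z' \<Longrightarrow> qform A' B' C' z = qform A' B' C' z'"
    and val: "\<And>q. Re q = 0 \<Longrightarrow> Im q < 0 \<Longrightarrow> \<exists>z\<in>unit_disc. qform A' B' C' z = q"
    and imY: "ucov Y ` unit_disc = Y"
    by (rule punct_disc_functions[folded Y_def]) (rule that; blast)
  have mem: "(\<lambda>x. if x \<in> X then k (s x) else 0) \<in> A_X X" if "k holomorphic_on UNIV" for k
    by (rule A_X_qform[OF imX that, of _ A B C]) (use s imX in auto)
  have s_mem: "s \<in> A_X X"
    by (rule A_X_qform[OF imX holomorphic_on_ident, of _ A B C]) (use s s0 in auto)
  note one_mem = unit_fun_in_A_X[OF imX] and one_mem' = unit_fun_in_A_X[OF imY]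
  have \<Psi>_one: "\<Psi> (unit_fun X) = unit_fun Y"
  proof -
    \<comment> \<open>Surjectivity gives a preimage u of the unit; multiplying u by the unit and
      applying \<open>\<Psi>\<close> identifies the image of the unit.\<close>
    obtain u where u: "u \<in> A_X X" "\<Psi> u = unit_fun Y"
      using bij one_mem' by (metis bij_betw_imp_surj_on imageE)
    have "1 \<in> hdom"
      using hdom[of 1] by simp
    then have "star_X Y 1 (\<Psi> u) (\<Psi> (unit_fun X)) = \<Psi> u"
      using mult[OF _ u(1) one_mem] star_X_unit(1)[OF imX u(1)] by metis
    then show ?thesis
      using star_X_unit(2)[OF imY im_\<Psi>[OF one_mem]] u(2) by metis
  qed
  \<comment> \<open>The linear coefficient of the star square of s in the parameter;
    \<open>s2\<close> is the constant one.\<close>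
  define w where "w = (\<lambda>x. if x \<in> X then (s x)\<^sup>2 - 1 else 0)"
  define s2 where "s2 = (\<lambda>x. if x \<in> X then (s x)\<^sup>2 else 0)"
  have w_mem: "w \<in> A_X X" and s2_mem: "s2 \<in> A_X X"
    unfolding w_def s2_def by (rule mem, intro holomorphic_intros)+
  have "s2 = (\<lambda>x. w x + unit_fun X x)"
    by (auto simp: s2_def w_def unit_fun_def)
  then have \<Psi>_s2: "\<Psi> s2 = (\<lambda>y. \<Psi> w y + unit_fun Y y)"
    using add[OF w_mem one_mem] \<Psi>_one by simp
  have star_s: "star_X X t s s = (\<lambda>x. s2 x + t * w x)" for t
  proof
    fix x show "star_X X t s s x = s2 x + t * w x"
    proof (cases "x \<in> X")
      case True
      then obtain z where z: "z \<in> unit_disc" "ucov X z = x"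
        "\<And>t f g. star_X X t f g x = star_D t (pull X f) (pull X g) z"
        using star_X_eq[OF imX] by metis
      have p: "pull X s z = qform A B C z" if "z \<in> unit_disc" for z
        using that s by (simp add: pull_def)
      have "star_D t (pull X s) (pull X s) z = (pull X s z)\<^sup>2 + t * ((pull X s z)\<^sup>2 - (A\<^sup>2 - B * C))"
        using star_D_qform_ident p z(1) by blast
      moreover have "pull X s z = s x"
        using z(1,2) by (simp add: pull_def)
      ultimately show ?thesis
        unfolding z(3) cas using True by (simp add: s2_def w_def)
    qed (simp add: star_X_def s2_def w_def)
  qed
  have \<Psi>_star: "star_X Y (of_real t) (\<Psi> s) (\<Psi> s) y = \<Psi> s2 y + of_real t * \<Psi> w y" if "t > 0" for t y
  proof -
    have "(\<lambda>x. of_real t * w x) = (\<lambda>x. if x \<in> X then of_real t * ((s x)\<^sup>2 - 1) else 0)"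
      by (auto simp: w_def)
    also have "\<dots> \<in> A_X X"
      by (rule mem, intro holomorphic_intros)
    finally have "\<Psi> (\<lambda>x. s2 x + of_real t * w x) = (\<lambda>y. \<Psi> s2 y + \<Psi> (\<lambda>x. of_real t * w x) y)"
      using add s2_mem by blast
    then show ?thesis
      unfolding mult[OF hdom[OF that] s_mem s_mem, symmetric] star_s scale[OF w_mem] by simp
  qed
  obtain h where h: "h holomorphic_on UNIV" and hs: "\<And>z. z \<in> unit_disc \<Longrightarrow> \<Psi> s (ucov Y z) = h (qform A' B' C' z)"
    using rep[OF im_\<Psi>[OF s_mem]] by blast
  have ode: "(h q)\<^sup>2 - 1 = q\<^sup>2 * (deriv h q)\<^sup>2" if q: "Re q = 0" "Im q < 0" for q
  proof -
    obtain z0 where z0: "z0 \<in> unit_disc" "qform A' B' C' z0 = q"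
      using val[OF q] by blast
    define y where "y = ucov Y z0"
    have y: "y \<in> Y"
      using imY z0 by (auto simp: y_def)
    then obtain z where z: "z \<in> unit_disc" "ucov Y z = y"
      "\<And>t f g. star_X Y t f g y = star_D t (pull Y f) (pull Y g) z"
      using star_X_eq[OF imY] by metis
    \<comment> \<open>The preimage used by the product need not be \<open>z0\<close>, but the form
      takes the same value at both.\<close>
    have Qz: "qform A' B' C' z = q"
      using inv[of z z0] z z0 by (simp add: y_def)
    have p: "pull Y (\<Psi> s) z = h (qform A' B' C' z)" if "z \<in> unit_disc" for z
      using that hs by (simp add: pull_def)
    have "\<Psi> s2 y + of_real t * \<Psi> w y =
        (\<Sum>n. cc (of_real t) n / fact n * (q\<^sup>2) ^ n * (deriv ^^ n) h q * (deriv ^^ n) h q)" if "0 < t" "t \<le> 1" for t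
    proof -
      have "\<Psi> s2 y + of_real t * \<Psi> w y = star_D (of_real t) (pull Y (\<Psi> s)) (pull Y (\<Psi> s)) z"
        using \<Psi>_star[OF \<open>0 < t\<close>] z(3) by metis
      also have "\<dots> = (\<Sum>n. cc (of_real t) n / fact n * (q\<^sup>2) ^ n * (deriv ^^ n) h q * (deriv ^^ n) h q)"
        using star_D_qform[OF h p h p z(1), of "q\<^sup>2" "of_real t"] cas' by (simp add: Qz)
      finally show ?thesis .
    qed
    \<comment> \<open>The coefficients are (h q)^2 for \<open>\<Psi> s2 y\<close> and q^2 (h' q)^2
      for \<open>\<Psi> w y\<close>; by \<open>\<Psi>_s2\<close> they differ by 1.\<close>
    from star_series_affine_imp[OF h this] show ?thesis
      using y by (simp add: \<Psi>_s2 unit_fun_def diff_eq_eq)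
  qed
  define c where "c = h 0"
  have hc: "h q = c" and c: "c\<^sup>2 = 1" for q
    using entire_solution_constant[OF h ode] by (auto simp: c_def)
  have "\<Psi> s y = c * unit_fun Y y" for y
  proof (cases "y \<in> Y")
    case True
    then obtain z where "z \<in> unit_disc" "y = ucov Y z"
      using imY by (metis imageE)
    then show ?thesis
      using hs hc True by (simp add: unit_fun_def)
  next
    case False
    then show ?thesis
      using im_\<Psi>[OF s_mem] by (simp add: unit_fun_def A_X_def)
  qed
  \<comment> \<open>The constant c already is the image of a constant on the annulus, so injectivity
    makes s equal to c there, against its zero.\<close>
  then have "\<Psi> s = \<Psi> (\<lambda>x. c * unit_fun X x)"
    unfolding scale[OF one_mem] \<Psi>_one by blast
  moreover have "(\<lambda>x. c * unit_fun X x) \<in> A_X X"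
    using mem[of "\<lambda>x. c"] by (simp add: unit_fun_def if_distrib cong: if_cong)
  ultimately have eq: "s = (\<lambda>x. c * unit_fun X x)"
    using bij s_mem by (metis bij_betw_imp_inj_on inj_onD)
  obtain z where z: "z \<in> unit_disc" "qform A B C z = 0"
    using zero by blast
  have "ucov X z \<in> X"
    using imX z by auto
  then have "s (ucov X z) = c"
    by (subst eq) (simp add: unit_fun_def)
  then show False
    using s[OF z(1)] z(2) c by simp
qed

end
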